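(* Fix $\alpha,\beta>0$. For $n\ge3$ let $S$ be a random $\alpha/\beta$-staircase tableau of size $n$ with law $\mathbb{P}_{n,\alpha,\beta}$, and let $A_n^{(3)}$ be the number of boxes $(n-j-1,j)$, $1\le j\le n-2$ (the third main diagonal), that contain $\alpha$. Then, as $n\to\infty$, $A_n^{(3)}$ converges in distribution to a Poisson random variable with parameter $1/2$.
   Context: A staircase tableau of size $n$ has boxes $(i,j)$ with $i,j\ge1$ and $i+j\le n+1$, rows numbered from the top and columns from the left. An $\alpha/\beta$-staircase tableau of size $n$ is a filling in which each box is empty or contains $\alpha$ or $\beta$, such that: all boxes in the same column and above an $\alpha$ are empty; all boxes in the same row and to the left of a $\beta$ are empty; every main-diagonal box (with $i+j=n+1$) contains a symbol. $\overline{\mathcal{S}}_n$ is the set of these. The weight is $wt(S)=\alpha^{N_\alpha}\beta^{N_\beta}$ ($N_\alpha,N_\beta$ the numbers of $\alpha$'s, $\beta$'s), and $\mathbb{P}_{n,\alpha,\beta}(S)=wt(S)/\sum_{T\in\overline{\mathcal{S}}_n}wt(T)$. *)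

theory Defs
  imports "HOL-Probability.Probability"
begin

datatype sym = Alpha | Beta

text \<open>A filling of the plane; boxes are pairs (row i, column j), rows numbered from the top.\<close>
type_synonym filling = "nat \<times> nat \<Rightarrow> sym option"

definition boxes :: "nat \<Rightarrow> (nat \<times> nat) set" where
  "boxes n = {(i, j). 1 \<le> i \<and> 1 \<le> j \<and> i + j \<le> n + 1}"

definition staircase_tableaux :: "nat \<Rightarrow> filling set" where
  "staircase_tableaux n = {S.
     (\<forall>b. b \<notin> boxes n \<longrightarrow> S b = None) \<and>
     (\<forall>i j. (i, j) \<in> boxes n \<and> S (i, j) = Some Alpha \<longrightarrow>
            (\<forall>i'. 1 \<le> i' \<and> i' < i \<longrightarrow> S (i', j) = None)) \<and>
     (\<forall>i j. (i, j) \<in> boxes n \<and> S (i, j) = Some Beta \<longrightarrow>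
            (\<forall>j'. 1 \<le> j' \<and> j' < j \<longrightarrow> S (i, j') = None)) \<and>
     (\<forall>i j. 1 \<le> i \<and> 1 \<le> j \<and> i + j = n + 1 \<longrightarrow> S (i, j) \<noteq> None)}"

definition N_alpha :: "nat \<Rightarrow> filling \<Rightarrow> nat" where
  "N_alpha n S = card {b \<in> boxes n. S b = Some Alpha}"

definition N_beta :: "nat \<Rightarrow> filling \<Rightarrow> nat" where
  "N_beta n S = card {b \<in> boxes n. S b = Some Beta}"

definition wt :: "real \<Rightarrow> real \<Rightarrow> nat \<Rightarrow> filling \<Rightarrow> real" where
  "wt \<alpha> \<beta> n S = \<alpha> ^ N_alpha n S * \<beta> ^ N_beta n S"

definition tableau_law :: "real \<Rightarrow> real \<Rightarrow> nat \<Rightarrow> filling pmf" where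
  "tableau_law \<alpha> \<beta> n = embed_pmf (\<lambda>S. if S \<in> staircase_tableaux n
      then wt \<alpha> \<beta> n S / (\<Sum>T\<in>staircase_tableaux n. wt \<alpha> \<beta> n T) else 0)"

definition A3 :: "nat \<Rightarrow> filling \<Rightarrow> nat" where
  "A3 n S = card {j \<in> {1..n-2}. S (n - j - 1, j) = Some Alpha}"

end

theory Submission
  imports Defs "HOL-Real_Asymp.Real_Asymp"
begin

text \<open>
  Removing the first column of a tableau of size \<open>n + 1\<close> leaves one of size \<open>n\<close>, and the possible
  first columns depend only on the set of rows without \<open>\<beta>\<close>. Hence the generating function of
  \<open>wt S * t ^ A3 S * x ^ f\<close>, with \<open>f\<close> the number of \<open>\<beta>\<close>-free rows of \<open>S\<close>, satisfies an exact linear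
  recursion in \<open>n\<close> and \<open>x\<close>. Divided by its value at \<open>t = 1\<close>, a power of \<open>\<alpha> \<beta>\<close> times a Pochhammer
  symbol, and with \<open>x = \<beta> s\<close> and \<open>y = s + 1 / \<alpha> + n - 1\<close>, the recursion becomes to leading order
  \<open>g y s = g y (s + 1) + (t - 1) * s / y^2 * g (y - 2) (s + 1)\<close>,
  which is solved by \<open>exp ((t - 1) * (1 - (s / y)^2) / 2)\<close>. As \<open>y\<close> grows with \<open>s\<close> fixed, this tends to
  \<open>exp ((t - 1) / 2)\<close>, the generating function of the Poisson law with parameter \<open>1/2\<close>, and on the
  unit circle Levy's continuity theorem applies.
\<close>

section \<open>Adding a first column\<close>

lemma tableau_outside:
  assumes "S \<in> staircase_tableaux n" "i = 0 \<or> j = 0 \<or> Suc n < i + j"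
  shows "S (i, j) = None"
proof -
  have "(i, j) \<notin> boxes n" using assms(2) by (auto simp: boxes_def)
  then show ?thesis using assms(1) unfolding staircase_tableaux_def by blast
qed

lemma tableau_mem_boxes: "S \<in> staircase_tableaux n \<Longrightarrow> S b = Some s \<Longrightarrow> b \<in> boxes n"
  unfolding staircase_tableaux_def mem_Collect_eq by (metis option.distinct(1))

lemma tableau_above_Alpha:
  assumes S: "S \<in> staircase_tableaux n" and "S (i, j) = Some Alpha" "i' < i"
  shows "S (i', j) = None"
proof (cases "i' = 0")
  case False
  have "\<forall>i'. 1 \<le> i' \<and> i' < i \<longrightarrow> S (i', j) = None"
    using S assms(2) tableau_mem_boxes[OF S assms(2)] unfolding staircase_tableaux_def by blast
  then show ?thesis using False assms(3) by simp
qed (use tableau_outside[OF S] in simp)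

lemma tableau_left_of_Beta:
  assumes S: "S \<in> staircase_tableaux n" and "S (i, j) = Some Beta" "j' < j"
  shows "S (i, j') = None"
proof (cases "j' = 0")
  case False
  have "\<forall>j'. 1 \<le> j' \<and> j' < j \<longrightarrow> S (i, j') = None"
    using S assms(2) tableau_mem_boxes[OF S assms(2)] unfolding staircase_tableaux_def by blast
  then show ?thesis using False assms(3) by simp
qed (use tableau_outside[OF S] in simp)

lemma tableau_diagonal:
  "S \<in> staircase_tableaux n \<Longrightarrow> 1 \<le> i \<Longrightarrow> 1 \<le> j \<Longrightarrow> i + j = n + 1 \<Longrightarrow> S (i, j) \<noteq> None"
  unfolding staircase_tableaux_def by blast

lemma tableauI:
  assumes "\<And>i j. i = 0 \<or> j = 0 \<or> Suc n < i + j \<Longrightarrow> S (i, j) = None"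
    and "\<And>i j i'. S (i, j) = Some Alpha \<Longrightarrow> i' < i \<Longrightarrow> S (i', j) = None"
    and "\<And>i j j'. S (i, j) = Some Beta \<Longrightarrow> j' < j \<Longrightarrow> S (i, j') = None"
    and "\<And>i j. 1 \<le> i \<Longrightarrow> 1 \<le> j \<Longrightarrow> i + j = n + 1 \<Longrightarrow> S (i, j) \<noteq> None"
  shows "S \<in> staircase_tableaux n"
  unfolding staircase_tableaux_def mem_Collect_eq
proof (intro conjI allI impI)
  fix c assume "c \<notin> boxes n"
  then show "S c = None"
    using assms(1) by (cases c) (auto simp: boxes_def)
qed (use assms(2-4) in blast)+

definition free_rows :: "nat \<Rightarrow> filling \<Rightarrow> nat set" where
  "free_rows n S = {i \<in> {1..n}. \<forall>j. S (i, j) \<noteq> Some Beta}"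

lemma free_rows_subset: "free_rows n S \<subseteq> {1..n}"
  by (auto simp: free_rows_def)

lemma finite_free_rows: "finite (free_rows n S)"
  by (simp add: free_rows_def)

definition top_row :: "nat \<Rightarrow> nat set \<Rightarrow> nat" where
  "top_row n M = Min (insert (Suc n) M)"

lemma top_row_empty [simp]: "top_row n {} = Suc n"
  by (simp add: top_row_def)

lemma
  assumes M: "M \<subseteq> {1..n}"
  shows top_row_mem: "top_row n M \<in> insert (Suc n) M"
    and top_row_le: "i \<in> insert (Suc n) M \<Longrightarrow> top_row n M \<le> i"
    and top_row_eqI: "k \<in> insert (Suc n) M \<Longrightarrow> (\<And>i. i \<in> insert (Suc n) M \<Longrightarrow> k \<le> i) \<Longrightarrow>
      top_row n M = k"
proof -
  have fin: "finite (insert (Suc n) M)" using M finite_subset by auto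
  show "top_row n M \<in> insert (Suc n) M"
    unfolding top_row_def using fin by (intro Min_in) auto
  show "i \<in> insert (Suc n) M \<Longrightarrow> top_row n M \<le> i"
    unfolding top_row_def using fin by (rule Min_le)
  show "k \<in> insert (Suc n) M \<Longrightarrow> (\<And>i. i \<in> insert (Suc n) M \<Longrightarrow> k \<le> i) \<Longrightarrow>
      top_row n M = k"
    unfolding top_row_def using fin by (intro Min_eqI)
qed

lemma top_row_mem_nonempty:
  assumes M: "M \<subseteq> {1..n}" and "M \<noteq> {}"
  shows "top_row n M \<in> M"
proof -
  obtain i where "i \<in> M" using \<open>M \<noteq> {}\<close> by blast
  then have "top_row n M \<le> n" using top_row_le[OF M, of i] M by auto
  then show ?thesis using top_row_mem[OF M] by auto
qed

text \<open>
  A first column is encoded by the set \<open>M\<close> of its occupied boxes off the diagonal and the bit \<open>q\<close>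
  that tells whether it contains an \<open>\<alpha>\<close>: only the topmost occupied box of a column can do so.
\<close>
definition column_entry :: "nat \<Rightarrow> nat set \<Rightarrow> bool \<Rightarrow> nat \<Rightarrow> sym option" where
  "column_entry n M q i =
     (if i \<in> insert (Suc n) M then Some (if q \<and> i = top_row n M then Alpha else Beta) else None)"

lemma column_entry_eq_None_iff: "column_entry n M q i = None \<longleftrightarrow> i \<notin> insert (Suc n) M"
  by (simp add: column_entry_def)

lemma column_entry_eq_Some_iff:
  "column_entry n M q i = Some s \<longleftrightarrow>
     i \<in> insert (Suc n) M \<and> (s = Alpha \<longleftrightarrow> q \<and> i = top_row n M)"
  by (cases s) (auto simp: column_entry_def)

fun add_column :: "nat \<Rightarrow> filling \<Rightarrow> nat set \<Rightarrow> bool \<Rightarrow> filling" where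
  "add_column n S M q (i, 0) = None"
| "add_column n S M q (i, Suc 0) = column_entry n M q i"
| "add_column n S M q (i, Suc (Suc j)) = S (i, Suc j)"

lemma nat_cases_0_1 [case_names zero one Suc_Suc]:
  "(j = 0 \<Longrightarrow> P) \<Longrightarrow> (j = Suc 0 \<Longrightarrow> P) \<Longrightarrow> (\<And>k. j = Suc (Suc k) \<Longrightarrow> P) \<Longrightarrow> P"
  by (metis not0_implies_Suc)

context
  fixes n :: nat and S :: filling and M :: "nat set"
  assumes S: "S \<in> staircase_tableaux n" and M: "M \<subseteq> free_rows n S"
begin

private lemma marks_subset: "M \<subseteq> {1..n}"
  using M free_rows_subset by blast

private lemma finite_marks: "finite M"
  using marks_subset finite_subset by blast

lemma add_column_tableau: "add_column n S M q \<in> staircase_tableaux (Suc n)"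
proof (rule tableauI)
  fix i j assume "i = 0 \<or> j = 0 \<or> Suc (Suc n) < i + j"
  then show "add_column n S M q (i, j) = None"
    using marks_subset tableau_outside[OF S]
    by (cases j rule: nat_cases_0_1) (auto simp: column_entry_eq_None_iff)
next
  fix i j i' assume "add_column n S M q (i, j) = Some Alpha" "i' < i"
  then show "add_column n S M q (i', j) = None"
    using top_row_le[OF marks_subset, of i'] tableau_above_Alpha[OF S]
    by (cases j rule: nat_cases_0_1) (auto simp: column_entry_eq_None_iff column_entry_eq_Some_iff)
next
  fix i j j' assume j: "add_column n S M q (i, j) = Some Beta" "j' < j"
  show "add_column n S M q (i, j') = None"
  proof (cases j rule: nat_cases_0_1)
    case (Suc_Suc k)
    then have beta: "S (i, Suc k) = Some Beta" using j(1) by simp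
    then have "i \<notin> insert (Suc n) M"
      using M tableau_mem_boxes[OF S beta] by (auto simp: free_rows_def boxes_def)
    then show ?thesis
      using j(2) Suc_Suc tableau_left_of_Beta[OF S beta]
      by (cases j' rule: nat_cases_0_1) (auto simp: column_entry_eq_None_iff)
  qed (use j in auto)
next
  fix i j :: nat assume "1 \<le> i" "1 \<le> j" "i + j = Suc n + 1"
  then show "add_column n S M q (i, j) \<noteq> None"
    using tableau_diagonal[OF S]
    by (cases j rule: nat_cases_0_1) (auto simp: column_entry_eq_None_iff)
qed

lemma free_rows_add_column:
  "free_rows (Suc n) (add_column n S M q) =
     (free_rows n S - M) \<union> (if q then {top_row n M} else {})"
proof -
  have row_free_iff: "(\<forall>j. add_column n S M q (i, j) \<noteq> Some Beta) \<longleftrightarrow>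
      (\<forall>j. S (i, j) \<noteq> Some Beta) \<and> column_entry n M q i \<noteq> Some Beta" (is "?new \<longleftrightarrow> ?old") for i
  proof
    assume new: ?new
    have "S (i, j) \<noteq> Some Beta" for j
      using new[rule_format, of "Suc j"] tableau_outside[OF S, of i j] by (cases j) auto
    moreover have "column_entry n M q i \<noteq> Some Beta"
      using new[rule_format, of "Suc 0"] by simp
    ultimately show ?old by blast
  next
    assume old: ?old
    have "add_column n S M q (i, j) \<noteq> Some Beta" for j
      using old by (cases j rule: nat_cases_0_1) auto
    then show ?new by blast
  qed
  have last_row_free: "S (Suc n, j) \<noteq> Some Beta" for j
    using tableau_mem_boxes[OF S, of "(Suc n, j)"] by (auto simp: boxes_def)
  have "top_row n M \<in> insert (Suc n) M"
    by (rule top_row_mem[OF marks_subset])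
  then show ?thesis
    unfolding free_rows_def row_free_iff column_entry_eq_Some_iff
    using M last_row_free by (auto simp: free_rows_def le_Suc_eq)
qed

lemma card_symbols_add_column:
  "card {c \<in> boxes (Suc n). add_column n S M q c = Some s} =
     card {c \<in> boxes n. S c = Some s} + card {i. column_entry n M q i = Some s}"
proof -
  have "{c \<in> boxes (Suc n). add_column n S M q c = Some s} =
      (\<lambda>(i, j). (i, Suc j)) ` {c \<in> boxes n. S c = Some s} \<union>
      (\<lambda>i. (i, 1)) ` {i. column_entry n M q i = Some s}" (is "_ = ?old \<union> ?new")
  proof (intro set_eqI)
    fix c :: "nat \<times> nat"
    obtain i j where "c = (i, j)" by fastforce
    then show "c \<in> {c \<in> boxes (Suc n). add_column n S M q c = Some s} \<longleftrightarrow> c \<in> ?old \<union> ?new"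
      using marks_subset
      by (cases j rule: nat_cases_0_1) (auto simp: boxes_def image_iff column_entry_eq_Some_iff)
  qed
  moreover have "?old \<inter> ?new = {}" by (auto simp: boxes_def)
  moreover have "finite ?old"
  proof -
    have "boxes n \<subseteq> {..n} \<times> {..n}" by (auto simp: boxes_def)
    then have "finite (boxes n)" by (rule finite_subset) simp
    then show ?thesis by simp
  qed
  moreover have "finite ?new"
    by (rule finite_imageI, rule finite_subset[of _ "insert (Suc n) M"])
      (auto simp: column_entry_eq_Some_iff finite_marks)
  moreover have "card ?old = card {c \<in> boxes n. S c = Some s}"
    by (rule card_image) (auto simp: inj_on_def)
  moreover have "card ?new = card {i. column_entry n M q i = Some s}"
    by (rule card_image) (auto simp: inj_on_def)
  ultimately show ?thesis by (simp add: card_Un_disjoint)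
qed

lemma N_alpha_add_column: "N_alpha (Suc n) (add_column n S M q) = N_alpha n S + of_bool q"
proof -
  have "{i. column_entry n M q i = Some Alpha} = (if q then {top_row n M} else {})"
    using top_row_mem[OF marks_subset] by (auto simp: column_entry_eq_Some_iff)
  then show ?thesis
    unfolding N_alpha_def card_symbols_add_column by simp
qed

lemma N_beta_add_column:
  "N_beta (Suc n) (add_column n S M q) = N_beta n S + card M + of_bool (\<not> q)"
proof -
  have "{i. column_entry n M q i = Some Beta} =
      insert (Suc n) M - (if q then {top_row n M} else {})"
    by (auto simp: column_entry_eq_Some_iff)
  moreover have "card (insert (Suc n) M) = Suc (card M)"
    using marks_subset finite_marks by (intro card_insert_disjoint) auto
  ultimately show ?thesis
    unfolding N_beta_def card_symbols_add_column
    using top_row_mem[OF marks_subset] finite_marks by (simp add: card_Diff_singleton)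
qed

lemma A3_add_column:
  "A3 (Suc n) (add_column n S M q) = A3 n S + of_bool (q \<and> top_row n M = n - 1)"
proof -
  have top: "top_row n M \<in> insert (Suc n) M" "top_row n M \<noteq> 0"
    using top_row_mem[OF marks_subset] marks_subset by (auto dest: subsetD)
  have "{j \<in> {1..Suc n - 2}. add_column n S M q (Suc n - j - 1, j) = Some Alpha} =
      Suc ` {j \<in> {1..n - 2}. S (n - j - 1, j) = Some Alpha} \<union>
      (if q \<and> top_row n M = n - 1 then {1} else {})" (is "?L = ?old \<union> ?new")
  proof (intro set_eqI)
    fix j
    show "j \<in> ?L \<longleftrightarrow> j \<in> ?old \<union> ?new"
      using top by (cases j rule: nat_cases_0_1) (auto simp: column_entry_eq_Some_iff)
  qed
  moreover have "?old \<inter> ?new = {}" by auto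
  moreover have "card ?old = A3 n S"
    unfolding A3_def by (rule card_image) simp
  ultimately show ?thesis
    unfolding A3_def by (simp add: card_Un_disjoint)
qed

end

fun del_column :: "filling \<Rightarrow> filling" where
  "del_column T (i, 0) = None"
| "del_column T (i, Suc j) = T (i, Suc (Suc j))"

definition column_marks :: "nat \<Rightarrow> filling \<Rightarrow> nat set" where
  "column_marks n T = {i \<in> {1..n}. T (i, 1) \<noteq> None}"

definition column_has_Alpha :: "filling \<Rightarrow> bool" where
  "column_has_Alpha T \<longleftrightarrow> (\<exists>i. T (i, 1) = Some Alpha)"

lemma del_column_add_column: "del_column (add_column n S M q) = S"
  if "S \<in> staircase_tableaux n"
proof
  fix c
  show "del_column (add_column n S M q) c = S c"
    using tableau_outside[OF that] by (cases "(S, c)" rule: del_column.cases) auto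
qed

lemma column_marks_add_column: "M \<subseteq> {1..n} \<Longrightarrow> column_marks n (add_column n S M q) = M"
  by (auto simp: column_marks_def column_entry_eq_Some_iff column_entry_eq_None_iff)

lemma column_has_Alpha_add_column: "M \<subseteq> {1..n} \<Longrightarrow> column_has_Alpha (add_column n S M q) \<longleftrightarrow> q"
  using top_row_mem by (auto simp: column_has_Alpha_def column_entry_eq_Some_iff)

context
  fixes n :: nat and T :: filling
  assumes T: "T \<in> staircase_tableaux (Suc n)"
begin

lemma del_column_tableau: "del_column T \<in> staircase_tableaux n"
proof (rule tableauI)
  fix i j :: nat assume "i = 0 \<or> j = 0 \<or> Suc n < i + j"
  then show "del_column T (i, j) = None"
    using tableau_outside[OF T, of i "Suc j"] by (cases j) auto
next
  fix i j i' assume "del_column T (i, j) = Some Alpha" "i' < i"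
  then show "del_column T (i', j) = None"
    using tableau_above_Alpha[OF T] by (cases j) auto
next
  fix i j j' assume "del_column T (i, j) = Some Beta" "j' < j"
  then show "del_column T (i, j') = None"
    using tableau_left_of_Beta[OF T, of i "Suc j" "Suc j'"] by (cases j; cases j') auto
next
  fix i j :: nat assume "1 \<le> i" "1 \<le> j" "i + j = n + 1"
  then show "del_column T (i, j) \<noteq> None"
    using tableau_diagonal[OF T, of i "Suc j"] by (cases j) auto
qed

lemma column_marks_subset_free_rows: "column_marks n T \<subseteq> free_rows n (del_column T)"
proof
  fix i assume i: "i \<in> column_marks n T"
  have "del_column T (i, j) \<noteq> Some Beta" for j
    using i tableau_left_of_Beta[OF T, of i "Suc j" 1] by (cases j) (auto simp: column_marks_def)
  then show "i \<in> free_rows n (del_column T)"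
    using i by (simp add: free_rows_def column_marks_def)
qed

private lemma occupied_iff_marked: "T (i, 1) \<noteq> None \<longleftrightarrow> i \<in> insert (Suc n) (column_marks n T)"
  using tableau_diagonal[OF T, of "Suc n" 1] tableau_outside[OF T, of i 1]
  by (cases "i = 0 \<or> Suc n < i") (auto simp: column_marks_def)

private lemma Alpha_imp_top_row:
  assumes "T (i, 1) = Some Alpha"
  shows "i = top_row n (column_marks n T)"
proof (rule top_row_eqI[symmetric])
  show "column_marks n T \<subseteq> {1..n}" by (auto simp: column_marks_def)
  show "i \<in> insert (Suc n) (column_marks n T)"
    using assms occupied_iff_marked[of i] by simp
  show "i \<le> k" if "k \<in> insert (Suc n) (column_marks n T)" for k
    using that occupied_iff_marked[of k] tableau_above_Alpha[OF T assms, of k] by (metis not_le)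
qed

lemma add_column_del_column:
  "add_column n (del_column T) (column_marks n T) (column_has_Alpha T) = T"
proof
  fix c :: "nat \<times> nat"
  obtain i j where c: "c = (i, j)" by fastforce
  have "column_entry n (column_marks n T) (column_has_Alpha T) i = T (i, 1)"
  proof (cases "T (i, 1)")
    case None
    then show ?thesis using occupied_iff_marked[of i] by (simp add: column_entry_eq_None_iff)
  next
    case (Some s)
    have "s = Alpha \<longleftrightarrow> column_has_Alpha T \<and> i = top_row n (column_marks n T)"
      using Some Alpha_imp_top_row unfolding column_has_Alpha_def by (metis option.inject)
    then show ?thesis
      using Some occupied_iff_marked[of i] by (simp add: column_entry_eq_Some_iff)
  qed
  then show "add_column n (del_column T) (column_marks n T) (column_has_Alpha T) c = T c"
    using tableau_outside[OF T] unfolding c by (cases j rule: nat_cases_0_1) auto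
qed

end

lemma bij_betw_add_column:
  "bij_betw (\<lambda>(S, M, q). add_column n S M q)
     (SIGMA S:staircase_tableaux n. Pow (free_rows n S) \<times> UNIV) (staircase_tableaux (Suc n))"
proof (rule bij_betw_byWitness[where
      f' = "\<lambda>T. (del_column T, column_marks n T, column_has_Alpha T)"])
  have "M \<subseteq> {1..n}" if "M \<subseteq> free_rows n S" for M S
    using that free_rows_subset by blast
  then show "\<forall>x\<in>SIGMA S:staircase_tableaux n. Pow (free_rows n S) \<times> UNIV.
      (\<lambda>T. (del_column T, column_marks n T, column_has_Alpha T))
        ((\<lambda>(S, M, q). add_column n S M q) x) = x"
    by (auto simp: del_column_add_column column_marks_add_column column_has_Alpha_add_column)
qed (auto simp: add_column_del_column intro: add_column_tableau del_column_tableau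
      dest: column_marks_subset_free_rows[THEN subsetD])

lemma staircase_tableaux_0: "staircase_tableaux 0 = {\<lambda>_. None}"
proof -
  have "S c = None" if "S \<in> staircase_tableaux 0" for S c
    using tableau_outside[OF that, of "fst c" "snd c"] by (cases c) fastforce
  moreover have "(\<lambda>_. None) \<in> staircase_tableaux 0"
    by (rule tableauI) auto
  ultimately show ?thesis by blast
qed

lemma finite_staircase_tableaux: "finite (staircase_tableaux n)"
proof (induction n)
  case (Suc n)
  then show ?case
    by (simp add: bij_betw_finite[OF bij_betw_add_column, symmetric] finite_free_rows)
qed (simp add: staircase_tableaux_0)

section \<open>Generating functions\<close>

definition tableau_weight :: "'a::comm_ring_1 \<Rightarrow> 'a \<Rightarrow> 'a \<Rightarrow> nat \<Rightarrow> filling \<Rightarrow> 'a" where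
  "tableau_weight a b t n S = a ^ N_alpha n S * b ^ N_beta n S * t ^ A3 n S"

definition tableau_sum :: "'a::comm_ring_1 \<Rightarrow> 'a \<Rightarrow> 'a \<Rightarrow> nat \<Rightarrow> (nat set \<Rightarrow> 'a) \<Rightarrow> 'a" where
  "tableau_sum a b t n \<phi> =
     (\<Sum>S\<in>staircase_tableaux n. tableau_weight a b t n S * \<phi> (free_rows n S))"

text \<open>
  Sums over the first columns that can be put in front of a tableau of size \<open>n\<close> with free rows \<open>F\<close>:
  over all of them, and over those that add an \<open>\<alpha>\<close> to the third diagonal.
\<close>
definition column_sum :: "'a::comm_ring_1 \<Rightarrow> 'a \<Rightarrow> nat \<Rightarrow> (nat set \<Rightarrow> 'a) \<Rightarrow> nat set \<Rightarrow> 'a" where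
  "column_sum a b n \<phi> F =
     (\<Sum>M\<in>Pow F. b ^ card M * (a * \<phi> (insert (top_row n M) (F - M)) + b * \<phi> (F - M)))"

definition A3_column_sum :: "'a::comm_ring_1 \<Rightarrow> 'a \<Rightarrow> nat \<Rightarrow> (nat set \<Rightarrow> 'a) \<Rightarrow> nat set \<Rightarrow> 'a" where
  "A3_column_sum a b n \<phi> F =
     (\<Sum>M\<in>{M \<in> Pow F. top_row n M = n - 1}. b ^ card M * (a * \<phi> (insert (n - 1) (F - M))))"

lemma tableau_sum_cong:
  "(\<And>F. F \<subseteq> {1..n} \<Longrightarrow> \<phi> F = \<psi> F) \<Longrightarrow> tableau_sum a b t n \<phi> = tableau_sum a b t n \<psi>"
  unfolding tableau_sum_def using free_rows_subset by (intro sum.cong refl) simp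

lemma tableau_sum_add:
  "tableau_sum a b t n (\<lambda>F. \<phi> F + \<psi> F) = tableau_sum a b t n \<phi> + tableau_sum a b t n \<psi>"
  by (simp add: tableau_sum_def distrib_left sum.distrib)

lemma tableau_sum_mult:
  "tableau_sum a b t n (\<lambda>F. c * \<phi> F) = c * tableau_sum a b t n \<phi>"
  by (simp add: tableau_sum_def sum_distrib_left mult_ac)

lemma tableau_sum_eq_0:
  "(\<And>F. F \<subseteq> {1..n} \<Longrightarrow> \<phi> F = 0) \<Longrightarrow> tableau_sum a b t n \<phi> = 0"
  unfolding tableau_sum_def using free_rows_subset by (intro sum.neutral) simp

lemma tableau_sum_0: "tableau_sum a b t 0 \<phi> = \<phi> {}"
proof -
  have "boxes 0 = {}" by (auto simp: boxes_def)
  then show ?thesis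
    by (simp add: tableau_sum_def tableau_weight_def staircase_tableaux_0 N_alpha_def N_beta_def
        A3_def free_rows_def)
qed

lemma tableau_weight_add_column:
  assumes "S \<in> staircase_tableaux n" "M \<subseteq> free_rows n S"
  shows "tableau_weight a b t (Suc n) (add_column n S M q) = tableau_weight a b t n S *
    (b ^ card M * (if q then a * t ^ of_bool (top_row n M = n - 1) else b))"
  using assms
  by (simp add: tableau_weight_def N_alpha_add_column N_beta_add_column A3_add_column power_add
      mult_ac)

lemma sum_new_columns:
  assumes S: "S \<in> staircase_tableaux n"
  shows "(\<Sum>(M, q)\<in>Pow (free_rows n S) \<times> UNIV. tableau_weight a b t (Suc n) (add_column n S M q) *
      \<phi> (free_rows (Suc n) (add_column n S M q))) = tableau_weight a b t n S *
    (column_sum a b n \<phi> (free_rows n S) + (t - 1) * A3_column_sum a b n \<phi> (free_rows n S))"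
proof -
  define F where "F = free_rows n S"
  have A3_sum: "A3_column_sum a b n \<phi> F =
      (\<Sum>M\<in>Pow F. if top_row n M = n - 1 then b ^ card M * (a * \<phi> (insert (n - 1) (F - M))) else 0)"
    unfolding A3_column_sum_def by (rule sum.inter_filter) (simp add: F_def finite_free_rows)
  have "(\<Sum>(M, q)\<in>Pow F \<times> UNIV. tableau_weight a b t (Suc n) (add_column n S M q) *
      \<phi> (free_rows (Suc n) (add_column n S M q))) =
    (\<Sum>M\<in>Pow F. \<Sum>q\<in>UNIV. tableau_weight a b t (Suc n) (add_column n S M q) *
      \<phi> (free_rows (Suc n) (add_column n S M q)))"
    by (simp add: sum.cartesian_product)
  also have "\<dots> = (\<Sum>M\<in>Pow F. tableau_weight a b t n S *
      (b ^ card M * (a * \<phi> (insert (top_row n M) (F - M)) + b * \<phi> (F - M)) + (t - 1) *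
       (if top_row n M = n - 1 then b ^ card M * (a * \<phi> (insert (n - 1) (F - M))) else 0)))"
  proof (rule sum.cong[OF refl])
    fix M assume "M \<in> Pow F"
    then have "M \<subseteq> free_rows n S" by (simp add: F_def)
    then show "(\<Sum>q\<in>UNIV. tableau_weight a b t (Suc n) (add_column n S M q) *
        \<phi> (free_rows (Suc n) (add_column n S M q))) = tableau_weight a b t n S *
      (b ^ card M * (a * \<phi> (insert (top_row n M) (F - M)) + b * \<phi> (F - M)) + (t - 1) *
       (if top_row n M = n - 1 then b ^ card M * (a * \<phi> (insert (n - 1) (F - M))) else 0))"
      by (simp add: UNIV_bool tableau_weight_add_column[OF S] free_rows_add_column[OF S] F_def
          algebra_simps)
  qed
  also have "\<dots> = tableau_weight a b t n S *
      (column_sum a b n \<phi> F + (t - 1) * A3_column_sum a b n \<phi> F)"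
    by (simp only: column_sum_def A3_sum sum.distrib sum_distrib_left[symmetric])
  finally show ?thesis unfolding F_def .
qed

lemma tableau_sum_Suc:
  "tableau_sum a b t (Suc n) \<phi> = tableau_sum a b t n (column_sum a b n \<phi>) +
     (t - 1) * tableau_sum a b t n (A3_column_sum a b n \<phi>)"
proof -
  let ?w = "\<lambda>T. tableau_weight a b t (Suc n) T * \<phi> (free_rows (Suc n) T)"
  have "tableau_sum a b t (Suc n) \<phi> =
      (\<Sum>(S, M, q)\<in>(SIGMA S:staircase_tableaux n. Pow (free_rows n S) \<times> UNIV).
         ?w (add_column n S M q))"
    unfolding tableau_sum_def
    by (subst sum.reindex_bij_betw[OF bij_betw_add_column[of n], symmetric])
      (simp add: case_prod_unfold)
  also have "\<dots> = (\<Sum>S\<in>staircase_tableaux n. \<Sum>(M, q)\<in>Pow (free_rows n S) \<times> UNIV.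
         ?w (add_column n S M q))"
    by (subst sum.Sigma) (simp_all add: finite_staircase_tableaux finite_free_rows)
  also have "\<dots> = tableau_sum a b t n
      (\<lambda>F. column_sum a b n \<phi> F + (t - 1) * A3_column_sum a b n \<phi> F)"
    unfolding tableau_sum_def by (intro sum.cong refl sum_new_columns)
  finally show ?thesis
    by (simp only: tableau_sum_add tableau_sum_mult)
qed

lemma sum_Pow_powers:
  fixes b x :: "'a::comm_ring_1"
  assumes "finite F"
  shows "(\<Sum>M\<in>Pow F. b ^ card M * x ^ card (F - M)) = (x + b) ^ card F"
  using prod_add[OF assms, of "\<lambda>_. b" "\<lambda>_. x"] by (simp add: add.commute)

abbreviation card_power :: "'a::comm_ring_1 \<Rightarrow> nat set \<Rightarrow> 'a" where
  "card_power x \<equiv> \<lambda>F. x ^ card F"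

lemma column_sum_power:
  assumes F: "F \<subseteq> {1..n}"
  shows "column_sum a b n (card_power x) F = (a * x + b) * (x + b) ^ card F"
proof -
  have fin: "finite F" using F finite_subset by blast
  have "card (insert (top_row n M) (F - M)) = Suc (card (F - M))" if "M \<subseteq> F" for M
  proof -
    have "top_row n M \<in> insert (Suc n) M" using that F by (intro top_row_mem) auto
    then have "top_row n M \<notin> F - M" using F by auto
    then show ?thesis using fin by simp
  qed
  then have "column_sum a b n (card_power x) F =
      (\<Sum>M\<in>Pow F. (a * x + b) * (b ^ card M * x ^ card (F - M)))"
    unfolding column_sum_def by (intro sum.cong refl) (simp add: algebra_simps)
  then show ?thesis
    by (simp add: sum_distrib_left[symmetric] sum_Pow_powers[OF fin])
qed

lemma top_row_eq_pred_iff: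
  assumes M: "M \<subseteq> {1..n}"
  shows "top_row n M = n - 1 \<longleftrightarrow> M = {n - 1} \<or> M = {n - 1, n}"
proof
  assume top: "top_row n M = n - 1"
  then have "n - 1 \<in> M" using top_row_mem[OF M] by auto
  moreover have "M \<subseteq> {n - 1, n}"
    using top_row_le[OF M] M unfolding top by fastforce
  ultimately show "M = {n - 1} \<or> M = {n - 1, n}" by blast
next
  assume "M = {n - 1} \<or> M = {n - 1, n}"
  then show "top_row n M = n - 1" using M by (auto intro!: top_row_eqI)
qed

lemma A3_column_sum_eq:
  assumes F: "F \<subseteq> {1..n}"
  shows "A3_column_sum a b n \<phi> F = (if n - 1 \<in> F
    then a * b * (\<phi> F + (if n \<in> F then b * \<phi> (F - {n}) else 0)) else 0)"
proof -
  have marks: "{M \<in> Pow F. top_row n M = n - 1} =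
      (if n - 1 \<in> F then {{n - 1}} \<union> (if n \<in> F then {{n - 1, n}} else {}) else {})"
  proof -
    have "{M \<in> Pow F. top_row n M = n - 1} = {M \<in> Pow F. M = {n - 1} \<or> M = {n - 1, n}}"
      by (intro Collect_cong conj_cong refl top_row_eq_pred_iff) (use F in blast)
    then show ?thesis by (simp only:) auto
  qed
  show ?thesis
  proof (cases "n - 1 \<in> F")
    case True
    then have "n - 1 \<noteq> n" using F by auto
    moreover from this have "{n - 1} \<noteq> {n - 1, n}" by auto
    moreover have "insert (n - 1) (F - {n - 1}) = F" "insert (n - 1) (F - {n - 1, n}) = F - {n}"
      using True \<open>n - 1 \<noteq> n\<close> by auto
    ultimately show ?thesis
      using True unfolding A3_column_sum_def marks by (simp add: algebra_simps)
  next
    case False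
    then show ?thesis unfolding A3_column_sum_def marks by simp
  qed
qed

lemma column_sum_last_row:
  assumes F: "F \<subseteq> {1..n}" and \<phi>: "\<And>F. F \<subseteq> {1..Suc n} \<Longrightarrow> Suc n \<notin> F \<Longrightarrow> \<phi> F = 0"
  shows "column_sum a b n \<phi> F = a * \<phi> (insert (Suc n) F)"
proof -
  have "column_sum a b n \<phi> F = (\<Sum>M\<in>Pow F. if M = {} then a * \<phi> (insert (Suc n) F) else 0)"
    unfolding column_sum_def
  proof (rule sum.cong[OF refl])
    fix M assume "M \<in> Pow F"
    then have M: "M \<subseteq> {1..n}" using F by auto
    have "\<phi> (F - M) = 0" using F by (intro \<phi>) auto
    moreover have "\<phi> (insert (top_row n M) (F - M)) = 0" if "M \<noteq> {}"
      using top_row_mem_nonempty[OF M that] M F by (intro \<phi>) auto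
    ultimately show "b ^ card M * (a * \<phi> (insert (top_row n M) (F - M)) + b * \<phi> (F - M)) =
        (if M = {} then a * \<phi> (insert (Suc n) F) else 0)"
      by (cases "M = {}") simp_all
  qed
  moreover have "finite F" using F finite_subset by blast
  ultimately show ?thesis by simp
qed

lemma tableau_sum_last_row:
  assumes "\<And>F. F \<subseteq> {1..Suc n} \<Longrightarrow> Suc n \<notin> F \<Longrightarrow> \<phi> F = 0"
  shows "tableau_sum a b t (Suc n) \<phi> = a * tableau_sum a b t n (\<lambda>F. \<phi> (insert (Suc n) F))"
proof -
  have "tableau_sum a b t n (column_sum a b n \<phi>) =
      tableau_sum a b t n (\<lambda>F. a * \<phi> (insert (Suc n) F))"
    by (intro tableau_sum_cong column_sum_last_row assms)
  moreover have "tableau_sum a b t n (A3_column_sum a b n \<phi>) = 0"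
  proof (rule tableau_sum_eq_0)
    fix F assume F: "F \<subseteq> {1..n}"
    then have "\<phi> F = 0" "\<phi> (F - {n}) = 0" by (auto intro!: assms)
    then show "A3_column_sum a b n \<phi> F = 0" by (simp add: A3_column_sum_eq[OF F])
  qed
  ultimately show ?thesis by (simp add: tableau_sum_Suc tableau_sum_mult)
qed

lemma column_sum_eq_0:
  assumes F: "F \<subseteq> {1..n}" "m \<notin> F" "m \<le> n"
    and \<phi>: "\<And>F. F \<subseteq> {1..Suc n} \<Longrightarrow> m \<notin> F \<Longrightarrow> \<phi> F = 0"
  shows "column_sum a b n \<phi> F = 0"
  unfolding column_sum_def
proof (intro sum.neutral ballI)
  fix M assume "M \<in> Pow F"
  then have "top_row n M \<in> insert (Suc n) F"
    using F(1) top_row_mem[of M n] by auto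
  then have "\<phi> (insert (top_row n M) (F - M)) = 0" "\<phi> (F - M) = 0"
    using F by (auto intro!: \<phi>)
  then show "b ^ card M * (a * \<phi> (insert (top_row n M) (F - M)) + b * \<phi> (F - M)) = 0"
    by simp
qed

lemma sum_Pow_insert:
  assumes "finite G" "m \<notin> G"
  shows "(\<Sum>M\<in>Pow (insert m G). f M) = (\<Sum>M\<in>Pow G. f M) + (\<Sum>M\<in>Pow G. f (insert m M))"
proof -
  have "inj_on (insert m) (Pow G)"
    using assms by (intro inj_onI) (metis Pow_iff insert_ident subsetD)
  moreover have "Pow G \<inter> insert m ` Pow G = {}" using assms by auto
  ultimately show ?thesis
    using assms by (simp add: Pow_insert sum.union_disjoint sum.reindex)
qed

text \<open>
  Only columns after which row \<^term>\<open>Suc k\<close> is free contribute: they leave that row empty or have their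
  \<open>\<alpha>\<close> in it.
\<close>
lemma column_sum_insert_last:
  assumes G: "G \<subseteq> {1..k}" and \<phi>: "\<And>F. F \<subseteq> {1..Suc (Suc k)} \<Longrightarrow> Suc k \<notin> F \<Longrightarrow> \<phi> F = 0"
  shows "column_sum a b (Suc k) \<phi> (insert (Suc k) G) = a * b * \<phi> (insert (Suc k) G) +
    (\<Sum>M\<in>Pow G. b ^ card M * (a * \<phi> (insert (top_row (Suc k) M) (insert (Suc k) (G - M))) +
       b * \<phi> (insert (Suc k) (G - M))))"
proof -
  define m where "m = Suc k"
  have fin: "finite G" and m_notin: "m \<notin> G" using G finite_subset by (auto simp: m_def)
  let ?f = "\<lambda>M. b ^ card M *
      (a * \<phi> (insert (top_row m M) (insert m G - M)) + b * \<phi> (insert m G - M))"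
  have "?f (insert m M) = (if M = {} then a * b * \<phi> (insert m G) else 0)" if "M \<in> Pow G" for M
  proof (cases "M = {}")
    case True
    have "top_row m {m} = m" by (rule top_row_eqI) (auto simp: m_def)
    moreover have "\<phi> G = 0" using G by (intro \<phi>) auto
    ultimately show ?thesis using True m_notin by (simp add: mult_ac)
  next
    case False
    then obtain i where "i \<in> M" by blast
    moreover have M: "insert m M \<subseteq> {1..m}" using that G by (auto simp: m_def)
    ultimately have "top_row m (insert m M) \<le> i" "i \<le> k"
      using top_row_le[OF M, of i] that G by auto
    then have "top_row m (insert m M) \<in> G"
      using top_row_mem[OF M] that by (auto simp: m_def)
    then have "\<phi> (insert (top_row m (insert m M)) (insert m G - insert m M)) = 0"
      "\<phi> (insert m G - insert m M) = 0"
      using G m_notin by (auto intro!: \<phi> simp: m_def)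
    then show ?thesis using False by simp
  qed
  then have marked: "(\<Sum>M\<in>Pow G. ?f (insert m M)) = a * b * \<phi> (insert m G)"
    using fin by simp
  have "insert m G - M = insert m (G - M)" if "M \<in> Pow G" for M
    using that m_notin by auto
  then show ?thesis
    unfolding column_sum_def m_def[symmetric] sum_Pow_insert[OF fin m_notin] marked
    by (simp add: add.commute)
qed

definition tableau_gf :: "'a::comm_ring_1 \<Rightarrow> 'a \<Rightarrow> 'a \<Rightarrow> nat \<Rightarrow> 'a \<Rightarrow> 'a" where
  "tableau_gf a b t n x = tableau_sum a b t n (card_power x)"

lemma tableau_gf_0 [simp]: "tableau_gf a b t 0 x = 1"
  by (simp add: tableau_gf_def tableau_sum_0)

lemma tableau_gf_Suc:
  "tableau_gf a b t (Suc n) x = (a * x + b) * tableau_gf a b t n (x + b) +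
     (t - 1) * tableau_sum a b t n (A3_column_sum a b n (card_power x))"
  unfolding tableau_gf_def tableau_sum_Suc tableau_sum_mult[symmetric]
  by (subst tableau_sum_cong[OF column_sum_power]) simp_all

lemma tableau_gf_Suc_small:
  assumes "n \<le> 1"
  shows "tableau_gf a b t (Suc n) x = (a * x + b) * tableau_gf a b t n (x + b)"
proof -
  have "tableau_sum a b t n (A3_column_sum a b n (card_power x)) = 0"
    using assms by (intro tableau_sum_eq_0) (auto simp: A3_column_sum_eq)
  then show ?thesis
    unfolding tableau_gf_Suc by simp
qed

lemma tableau_gf_small:
  assumes "n \<le> 2"
  shows "tableau_gf a b t n x = tableau_gf a b 1 n x"
  using assms by (induction n arbitrary: x) (simp_all add: tableau_gf_Suc_small)

lemma A3_column_sum_power: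
  assumes G: "G \<subseteq> {1..k}"
  shows "A3_column_sum a b (Suc (Suc k)) (card_power x) (insert (Suc k) G) =
      a * b * x ^ Suc (card G)"
    and "A3_column_sum a b (Suc (Suc k)) (card_power x) (insert (Suc (Suc k)) (insert (Suc k) G)) =
      a * b * (x ^ Suc (Suc (card G)) + b * x ^ Suc (card G))"
proof -
  have new: "finite G" "Suc k \<notin> G" "Suc (Suc k) \<notin> G"
    and subset: "insert (Suc k) G \<subseteq> {1..Suc (Suc k)}"
      "insert (Suc (Suc k)) (insert (Suc k) G) \<subseteq> {1..Suc (Suc k)}"
    using G finite_subset by auto
  show "A3_column_sum a b (Suc (Suc k)) (card_power x) (insert (Suc k) G) =
      a * b * x ^ Suc (card G)"
    using new by (simp add: A3_column_sum_eq[OF subset(1)])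
  have "insert (Suc (Suc k)) (insert (Suc k) G) - {Suc (Suc k)} = insert (Suc k) G"
    using new by auto
  then show
    "A3_column_sum a b (Suc (Suc k)) (card_power x) (insert (Suc (Suc k)) (insert (Suc k) G)) =
      a * b * (x ^ Suc (Suc (card G)) + b * x ^ Suc (card G))"
    using new by (simp add: A3_column_sum_eq[OF subset(2)])
qed

lemma column_sum_A3_column_sum_power:
  assumes G: "G \<subseteq> {1..k}"
  shows
    "column_sum a b (Suc k) (A3_column_sum a b (Suc (Suc k)) (card_power x)) (insert (Suc k) G) =
    a * b * x * ((a * x + b) * (x + b) ^ card G + 2 * a * b * x ^ card G)"
proof -
  let ?\<psi> = "A3_column_sum a b (Suc (Suc k)) (card_power x)"
  have fin: "finite G" using G finite_subset by blast
  have summand: "b ^ card M * (a * ?\<psi> (insert (top_row (Suc k) M) (insert (Suc k) (G - M))) +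
        b * ?\<psi> (insert (Suc k) (G - M))) =
      a * b * x * (a * x + b) * (b ^ card M * x ^ card (G - M)) +
        (if M = {} then a * b * (a * b * x ^ Suc (card G)) else 0)" if "M \<in> Pow G" for M
  proof (cases "M = {}")
    case True
    then show ?thesis
      by (simp add: A3_column_sum_power[OF G] algebra_simps)
  next
    case False
    have M: "G - M \<subseteq> {1..k}" "M \<subseteq> {1..k}" "M \<subseteq> G" using that G by auto
    define i where "i = top_row (Suc k) M"
    have i: "i \<in> M" using False M(2) unfolding i_def by (intro top_row_mem_nonempty) auto
    have "?\<psi> (insert (Suc k) (insert i (G - M))) = a * b * x ^ Suc (Suc (card (G - M)))"
      using i M fin by (subst A3_column_sum_power(1)) auto
    then show ?thesis
      using False unfolding i_def[symmetric] A3_column_sum_power(1)[OF M(1)]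
      by (simp add: insert_commute algebra_simps)
  qed
  have "column_sum a b (Suc k) ?\<psi> (insert (Suc k) G) = a * b * ?\<psi> (insert (Suc k) G) +
      (\<Sum>M\<in>Pow G. a * b * x * (a * x + b) * (b ^ card M * x ^ card (G - M)) +
        (if M = {} then a * b * (a * b * x ^ Suc (card G)) else 0))"
    using summand by (subst column_sum_insert_last[OF G]) (simp_all add: A3_column_sum_eq)
  also have "\<dots> = a * b * x * ((a * x + b) * (x + b) ^ card G + 2 * a * b * x ^ card G)"
    using fin by (simp add: A3_column_sum_power(1)[OF G] sum.distrib sum_distrib_left[symmetric]
        sum_Pow_powers algebra_simps)
  finally show ?thesis .
qed

lemma A3_column_sum_A3_column_sum_power:
  assumes F: "F \<subseteq> {1..Suc k}"
  shows "A3_column_sum a b (Suc k) (A3_column_sum a b (Suc (Suc k)) (card_power x)) F =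
    (if Suc k \<in> F \<and> k \<in> F then (a * b)\<^sup>2 * x ^ card F else 0)"
proof -
  have "F \<subseteq> {1..Suc (Suc k)}" "F - {Suc k} \<subseteq> {1..Suc (Suc k)}" "Suc (Suc k) \<notin> F"
    using F by auto
  then show ?thesis
    by (simp add: A3_column_sum_eq[OF F] A3_column_sum_eq[of _ "Suc (Suc k)"] power2_eq_square
        mult_ac)
qed

lemma tableau_sum_last_row_power:
  "tableau_sum a b t k (\<lambda>F. if k \<in> F then x ^ card F else 0) =
     (if k = 0 then 0 else a * x * tableau_gf a b t (k - 1) x)"
proof (cases k)
  case (Suc l)
  have "tableau_sum a b t (Suc l) (\<lambda>F. if Suc l \<in> F then x ^ card F else 0) =
      a * tableau_sum a b t l (\<lambda>F. x ^ card (insert (Suc l) F))"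
    by (subst tableau_sum_last_row) simp_all
  also have "tableau_sum a b t l (\<lambda>F. x ^ card (insert (Suc l) F)) =
      tableau_sum a b t l (\<lambda>F. x * x ^ card F)"
  proof (rule tableau_sum_cong)
    fix F assume "F \<subseteq> {1..l}"
    then have "finite F" "Suc l \<notin> F" using finite_subset by auto
    then show "x ^ card (insert (Suc l) F) = x * x ^ card F" by simp
  qed
  finally show ?thesis
    using Suc by (simp add: tableau_sum_mult tableau_gf_def mult.assoc)
qed (simp add: tableau_sum_0)

lemma tableau_sum_A3_column_sum_power:
  "tableau_sum a b t (k + 2) (A3_column_sum a b (k + 2) (card_power x)) =
     a\<^sup>2 * b * x * ((a * x + b) * tableau_gf a b t k (x + b) + 2 * a * b * tableau_gf a b t k x +
       (if k = 0 then 0 else (t - 1) * a\<^sup>2 * b * x * tableau_gf a b t (k - 1) x))"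
proof -
  let ?\<psi> = "A3_column_sum a b (Suc (Suc k)) (card_power x)"
  have support: "?\<psi> F = 0" if "F \<subseteq> {1..Suc (Suc k)}" "Suc k \<notin> F" for F
    using that by (simp add: A3_column_sum_eq)
  have "tableau_sum a b t (Suc k) (column_sum a b (Suc k) ?\<psi>) =
      a * tableau_sum a b t k (\<lambda>G. column_sum a b (Suc k) ?\<psi> (insert (Suc k) G))"
    by (intro tableau_sum_last_row column_sum_eq_0[where m = "Suc k"] support) auto
  also have "tableau_sum a b t k (\<lambda>G. column_sum a b (Suc k) ?\<psi> (insert (Suc k) G)) =
      tableau_sum a b t k (\<lambda>G. a * b * x *
        ((a * x + b) * (x + b) ^ card G + 2 * a * b * x ^ card G))"
    by (intro tableau_sum_cong column_sum_A3_column_sum_power)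
  finally have all_columns: "tableau_sum a b t (Suc k) (column_sum a b (Suc k) ?\<psi>) =
      a\<^sup>2 * b * x * ((a * x + b) * tableau_gf a b t k (x + b) + 2 * a * b * tableau_gf a b t k x)"
    by (simp add: tableau_sum_mult tableau_sum_add tableau_gf_def power2_eq_square mult_ac)
  have "tableau_sum a b t (Suc k) (A3_column_sum a b (Suc k) ?\<psi>) =
      a * tableau_sum a b t k (\<lambda>G. A3_column_sum a b (Suc k) ?\<psi> (insert (Suc k) G))"
    by (intro tableau_sum_last_row) (simp add: A3_column_sum_A3_column_sum_power)
  also have "tableau_sum a b t k (\<lambda>G. A3_column_sum a b (Suc k) ?\<psi> (insert (Suc k) G)) =
      tableau_sum a b t k (\<lambda>G. (a * b)\<^sup>2 * x * (if k \<in> G then x ^ card G else 0))"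
  proof (rule tableau_sum_cong)
    fix G assume "G \<subseteq> {1..k}"
    then have "insert (Suc k) G \<subseteq> {1..Suc k}" "finite G" "Suc k \<notin> G"
      using finite_subset by auto
    then show "A3_column_sum a b (Suc k) ?\<psi> (insert (Suc k) G) =
        (a * b)\<^sup>2 * x * (if k \<in> G then x ^ card G else 0)"
      by (simp add: A3_column_sum_A3_column_sum_power mult_ac)
  qed
  finally have A3_columns: "tableau_sum a b t (Suc k) (A3_column_sum a b (Suc k) ?\<psi>) =
      a\<^sup>2 * b * x * (if k = 0 then 0 else a\<^sup>2 * b * x * tableau_gf a b t (k - 1) x)"
    by (simp add: tableau_sum_mult tableau_sum_last_row_power power2_eq_square mult_ac)
  show ?thesis
    unfolding add_2_eq_Suc' tableau_sum_Suc[of _ _ _ "Suc k"] all_columns A3_columns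
    by (simp add: algebra_simps)
qed

text \<open>
  An \<open>\<alpha>\<close> on the third diagonal restricts the two columns to its right so much that they can be
  removed together with it.
\<close>
lemma tableau_gf_rec:
  "tableau_gf a b t (k + 3) x = (a * x + b) * tableau_gf a b t (k + 2) (x + b) +
     (t - 1) * a\<^sup>2 * b * x * ((a * x + b) * tableau_gf a b t k (x + b) +
       2 * a * b * tableau_gf a b t k x +
       (if k = 0 then 0 else (t - 1) * a\<^sup>2 * b * x * tableau_gf a b t (k - 1) x))"
proof -
  have "k + 3 = Suc (k + 2)" by simp
  then show ?thesis
    by (simp only: tableau_gf_Suc[of _ _ _ "k + 2"] tableau_sum_A3_column_sum_power mult.assoc)
qed

lemma tableau_gf_at_1:
  fixes a b s :: "'a::field"
  assumes "a \<noteq> 0"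
  shows "tableau_gf a b 1 n (b * s) = (a * b) ^ n * pochhammer (s + 1 / a) n"
proof (induction n arbitrary: s)
  case (Suc n)
  have "tableau_gf a b 1 (Suc n) (b * s) =
      (a * (b * s) + b) * tableau_gf a b 1 n (b * (s + 1))"
    by (simp add: tableau_gf_Suc algebra_simps)
  also have "a * (b * s) + b = a * b * (s + 1 / a)"
    using assms by (simp add: algebra_simps)
  finally show ?case
    by (simp add: Suc.IH pochhammer_rec add_ac mult_ac)
qed simp

lemma tableau_gf_pos:
  fixes \<alpha> \<beta> x :: real
  assumes "\<alpha> > 0" "\<beta> > 0" "x \<ge> 0"
  shows "tableau_gf \<alpha> \<beta> 1 n x > 0"
  using tableau_gf_at_1[of \<alpha> \<beta> n "x / \<beta>"] assms by (simp add: pochhammer_pos add_nonneg_pos)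

lemma tableau_gf_of_real:
  "tableau_gf (of_real \<alpha>) (of_real \<beta>) 1 n (of_real x) = (of_real (tableau_gf \<alpha> \<beta> 1 n x) :: complex)"
  by (simp add: tableau_gf_def tableau_sum_def tableau_weight_def)

lemma norm_tableau_gf_le:
  fixes t :: complex
  assumes "\<alpha> \<ge> 0" "\<beta> \<ge> 0" "norm t \<le> 1" "x \<ge> 0"
  shows "norm (tableau_gf (of_real \<alpha>) (of_real \<beta>) t n (of_real x)) \<le> tableau_gf \<alpha> \<beta> 1 n x"
  unfolding tableau_gf_def tableau_sum_def
proof (rule sum_norm_le)
  fix S
  have "\<alpha> ^ N_alpha n S * \<beta> ^ N_beta n S * x ^ card (free_rows n S) * norm t ^ A3 n S \<le>
      \<alpha> ^ N_alpha n S * \<beta> ^ N_beta n S * x ^ card (free_rows n S)"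
    using assms by (intro mult_left_le power_le_one mult_nonneg_nonneg) auto
  then show "norm (tableau_weight (of_real \<alpha>) (of_real \<beta>) t n S * of_real x ^ card (free_rows n S))
      \<le> tableau_weight \<alpha> \<beta> 1 n S * x ^ card (free_rows n S)"
    using assms by (simp add: tableau_weight_def norm_mult norm_power mult_ac)
qed

section \<open>The limiting generating function\<close>

definition limit_profile :: "complex \<Rightarrow> complex \<Rightarrow> complex" where
  "limit_profile \<tau> u = exp (\<tau> / 2 * (1 - u\<^sup>2))"

lemma norm_limit_profile:
  assumes "Re \<tau> \<le> 0" "0 \<le> u" "u \<le> 1"
  shows "norm (limit_profile \<tau> (of_real u)) \<le> 1"
proof -
  have "u\<^sup>2 \<le> 1" using assms(2,3) by (rule power_le_one)
  then have "Re \<tau> * (1 - u\<^sup>2) \<le> 0" using assms(1) by (intro mult_nonpos_nonneg) auto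
  moreover have "\<tau> / 2 * (1 - (of_real u)\<^sup>2) = of_real ((1 - u\<^sup>2) / 2) * \<tau>" by simp
  ultimately show ?thesis
    unfolding limit_profile_def norm_exp_eq_Re by (simp add: mult.commute)
qed

lemma limit_profile_deriv:
  "(limit_profile \<tau> has_field_derivative - \<tau> * u * limit_profile \<tau> u) (at u within S)"
  unfolding limit_profile_def by (auto intro!: derivative_eq_intros)

lemma limit_profile_deriv2:
  "((\<lambda>u. - \<tau> * u * limit_profile \<tau> u) has_field_derivative
     (\<tau>\<^sup>2 * u\<^sup>2 - \<tau>) * limit_profile \<tau> u) (at u within S)"
  by (auto intro!: derivative_eq_intros limit_profile_deriv simp: algebra_simps power2_eq_square)

lemma closed_segment_0_1_complex: "closed_segment 0 1 = (of_real ` {0..1} :: complex set)"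
  using closed_segment_of_real[of 0 1] by (simp add: closed_segment_eq_real_ivl)

lemma limit_profile_Lipschitz:
  assumes "Re \<tau> \<le> 0" "u \<in> {0..1}" "v \<in> {0..1}"
  shows "norm (limit_profile \<tau> (of_real u) - limit_profile \<tau> (of_real v)) \<le> norm \<tau> * \<bar>u - v\<bar>"
proof -
  have "norm (- \<tau> * z * limit_profile \<tau> z) \<le> norm \<tau>" if "z \<in> of_real ` {0..1}" for z
    using that norm_limit_profile[OF assms(1)]
    by (auto simp: norm_mult mult_left_le mult_le_one mult.assoc)
  then have "norm (limit_profile \<tau> (of_real u) - limit_profile \<tau> (of_real v)) \<le>
      norm \<tau> * norm (of_real u - of_real v :: complex)"
    using assms(2,3) unfolding closed_segment_0_1_complex[symmetric]
    by (intro field_differentiable_bound[OF convex_closed_segment[of 0 1] limit_profile_deriv])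
      (auto simp: closed_segment_0_1_complex)
  then show ?thesis by (simp add: of_real_diff[symmetric] del: of_real_diff)
qed

lemma limit_profile_Taylor:
  assumes "Re \<tau> \<le> 0" "u \<in> {0..1}" "v \<in> {0..1}"
  shows "norm (limit_profile \<tau> (of_real v) - limit_profile \<tau> (of_real u) +
      \<tau> * of_real (u * (v - u)) * limit_profile \<tau> (of_real u)) \<le>
    (norm \<tau> + (norm \<tau>)\<^sup>2) * (v - u)\<^sup>2"
proof -
  define f where "f i z = (if i = 0 then limit_profile \<tau> z else
      if i = 1 then - \<tau> * z * limit_profile \<tau> z else (\<tau>\<^sup>2 * z\<^sup>2 - \<tau>) * limit_profile \<tau> z)"
    for i :: nat and z
  have "norm (f 2 z) \<le> norm \<tau> + (norm \<tau>)\<^sup>2" if "z \<in> of_real ` {0..1}" for z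
  proof -
    have z: "norm z \<le> 1" "norm (limit_profile \<tau> z) \<le> 1"
      using that norm_limit_profile[OF assms(1)] by auto
    have "norm (\<tau>\<^sup>2 * z\<^sup>2 - \<tau>) \<le> (norm \<tau>)\<^sup>2 * (norm z)\<^sup>2 + norm \<tau>"
      using norm_triangle_ineq4[of "\<tau>\<^sup>2 * z\<^sup>2" \<tau>] by (simp add: norm_mult norm_power)
    also have "\<dots> \<le> (norm \<tau>)\<^sup>2 * 1 + norm \<tau>"
      using z(1) by (intro add_right_mono mult_left_mono power_le_one) auto
    finally have "norm (\<tau>\<^sup>2 * z\<^sup>2 - \<tau>) * norm (limit_profile \<tau> z) \<le> (norm \<tau> + (norm \<tau>)\<^sup>2) * 1"
      using z(2) by (intro mult_mono) auto
    then show ?thesis by (simp add: f_def norm_mult)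
  qed
  moreover have "(f i has_field_derivative f (Suc i) z) (at z within S)" if "i \<le> 1" for i z S
    using that limit_profile_deriv[of \<tau> z S] limit_profile_deriv2[of \<tau> z S]
    by (cases "i = 0") (auto simp: f_def[abs_def] le_Suc_eq)
  ultimately have "norm (f 0 (of_real v) -
      (\<Sum>i\<le>1. f i (of_real u) * (of_real v - of_real u) ^ i / fact i)) \<le>
      (norm \<tau> + (norm \<tau>)\<^sup>2) * norm (of_real v - of_real u :: complex) ^ Suc 1 / fact 1"
    using assms(2,3) by (intro field_Taylor[OF convex_closed_segment[of 0 1]])
      (auto simp: closed_segment_0_1_complex numeral_2_eq_2)
  moreover have "norm (of_real v - of_real u :: complex) = \<bar>v - u\<bar>"
    by (simp add: of_real_diff[symmetric] del: of_real_diff)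
  ultimately show ?thesis
    by (simp add: f_def algebra_simps power2_eq_square)
qed

lemma limit_profile_increment:
  assumes \<tau>: "Re \<tau> \<le> 0" and s: "0 \<le> s" "s + 1 \<le> y"
  shows "norm (limit_profile \<tau> (of_real ((s + 1) / y)) - limit_profile \<tau> (of_real (s / y)) +
      \<tau> * of_real (s / y\<^sup>2) * limit_profile \<tau> (of_real (s / y))) \<le>
    (norm \<tau> + (norm \<tau>)\<^sup>2) / y\<^sup>2"
proof -
  have "s / y \<in> {0..1}" "(s + 1) / y \<in> {0..1}" using s by auto
  moreover have "(s + 1) / y - s / y = 1 / y" by (simp add: diff_divide_distrib[symmetric])
  ultimately show ?thesis
    using limit_profile_Taylor[OF \<tau>, of "s / y" "(s + 1) / y"] by (simp add: power2_eq_square)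
qed

lemma limit_profile_shift:
  assumes \<tau>: "Re \<tau> \<le> 0" and s: "0 \<le> s" "s + 1 \<le> y - 2"
  shows "norm (limit_profile \<tau> (of_real (s / y)) - limit_profile \<tau> (of_real ((s + 1) / (y - 2)))) \<le>
    norm \<tau> * (3 / y)"
proof -
  have "(s + 1) / (y - 2) - s / y = (y + 2 * s) / (y * (y - 2))"
    using s by (simp add: field_simps)
  also have "\<dots> \<le> 3 * (y - 2) / (y * (y - 2))"
    using s by (intro divide_right_mono) auto
  also have "\<dots> = 3 / y"
    using s by (intro nonzero_mult_divide_mult_cancel_right) simp
  finally have "(s + 1) / (y - 2) - s / y \<le> 3 / y" .
  moreover have "s / y \<le> (s + 1) / (y - 2)" using s by (intro frac_le) auto
  ultimately have "norm \<tau> * \<bar>s / y - (s + 1) / (y - 2)\<bar> \<le> norm \<tau> * (3 / y)"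
    by (intro mult_left_mono) auto
  moreover have "s / y \<in> {0..1}" "(s + 1) / (y - 2) \<in> {0..1}" using s by auto
  ultimately show ?thesis
    using limit_profile_Lipschitz[OF \<tau>, of "s / y" "(s + 1) / (y - 2)"] by linarith
qed

lemma abs_divide_pronic_le:
  fixes s y :: real
  assumes "0 \<le> s" "s \<le> y - 1" "1 < y"
  shows "\<bar>s / (y * (y - 1))\<bar> \<le> 1 / y"
  using assms mult_right_mono[of "s / (y - 1)" 1 "1 / y"] by (simp add: mult.commute)

lemma abs_divide_pronic_minus_divide_square_le:
  fixes s y :: real
  assumes "0 \<le> s" "s \<le> y - 1" "1 < y"
  shows "\<bar>s / (y * (y - 1)) - s / y\<^sup>2\<bar> \<le> 1 / y\<^sup>2"
proof -
  have "s / (y * (y - 1)) - s / y\<^sup>2 = s / (y - 1) * (1 / y\<^sup>2)"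
    using assms by (simp add: field_simps power2_eq_square)
  moreover have "s / (y - 1) * (1 / y\<^sup>2) \<le> 1 * (1 / y\<^sup>2)"
    using assms by (intro mult_right_mono) auto
  moreover have "s / (y - 1) * (1 / y\<^sup>2) \<ge> 0" using assms by simp
  ultimately show ?thesis by (simp only: abs_of_nonneg)
qed

lemma limit_profile_residual:
  assumes \<tau>: "Re \<tau> \<le> 0" and s: "0 \<le> s" "s + 1 \<le> y - 2"
  shows "norm (limit_profile \<tau> (of_real (s / y)) - limit_profile \<tau> (of_real ((s + 1) / y)) -
      \<tau> * of_real (s / (y * (y - 1))) * limit_profile \<tau> (of_real ((s + 1) / (y - 2)))) \<le>
    (2 * norm \<tau> + 4 * (norm \<tau>)\<^sup>2) / y\<^sup>2"
proof -
  define u v w where "u = limit_profile \<tau> (of_real (s / y))"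
    and "v = limit_profile \<tau> (of_real ((s + 1) / y))"
    and "w = limit_profile \<tau> (of_real ((s + 1) / (y - 2)))"
  have increment: "norm (v - u + \<tau> * of_real (s / y\<^sup>2) * u) \<le> (norm \<tau> + (norm \<tau>)\<^sup>2) / y\<^sup>2"
    unfolding u_def v_def using s by (intro limit_profile_increment[OF \<tau>]) auto
  have coeff: "norm (\<tau> * of_real (s / (y * (y - 1)) - s / y\<^sup>2) * u) \<le> norm \<tau> / y\<^sup>2"
  proof -
    have "\<bar>s / (y * (y - 1)) - s / y\<^sup>2\<bar> \<le> 1 / y\<^sup>2"
      using s by (intro abs_divide_pronic_minus_divide_square_le) auto
    moreover have "norm u \<le> 1"
      unfolding u_def using s by (intro norm_limit_profile[OF \<tau>]) auto
    ultimately have "norm \<tau> * \<bar>s / (y * (y - 1)) - s / y\<^sup>2\<bar> * norm u \<le> norm \<tau> * (1 / y\<^sup>2) * 1"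
      by (intro mult_mono) auto
    then show ?thesis by (simp only: norm_mult norm_of_real) simp
  qed
  have shift: "norm (\<tau> * of_real (s / (y * (y - 1))) * (u - w)) \<le> 3 * (norm \<tau>)\<^sup>2 / y\<^sup>2"
  proof -
    have "norm \<tau> * \<bar>s / (y * (y - 1))\<bar> * norm (u - w) \<le> norm \<tau> * (1 / y) * (norm \<tau> * (3 / y))"
      using limit_profile_shift[OF \<tau> s] s abs_divide_pronic_le[of s y]
      by (intro mult_mono) (auto simp: u_def w_def)
    then show ?thesis
      by (simp only: norm_mult norm_of_real) (simp add: power2_eq_square mult_ac)
  qed
  have "u - v - \<tau> * of_real (s / (y * (y - 1))) * w = - (v - u + \<tau> * of_real (s / y\<^sup>2) * u)
      - \<tau> * of_real (s / (y * (y - 1)) - s / y\<^sup>2) * u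
      + \<tau> * of_real (s / (y * (y - 1))) * (u - w)"
    by (simp only: of_real_diff right_diff_distrib left_diff_distrib) simp
  also have "norm \<dots> \<le> (norm \<tau> + (norm \<tau>)\<^sup>2) / y\<^sup>2 + norm \<tau> / y\<^sup>2 + 3 * (norm \<tau>)\<^sup>2 / y\<^sup>2"
    by (intro norm_triangle_mono order_trans[OF norm_triangle_ineq4] add_mono)
      (simp_all only: norm_minus_cancel increment coeff shift)
  also have "\<dots> = (2 * norm \<tau> + 4 * (norm \<tau>)\<^sup>2) / y\<^sup>2"
    by (simp add: add_divide_distrib[symmetric])
  finally show ?thesis unfolding u_def v_def w_def .
qed

text \<open>
  With \<open>u = s / y\<close> the recursion for the error is a discretisation of \<open>- h' = 2 * u * h\<close>, for which
  \<open>h u = 6/5 - u\<close> is a strict supersolution on the unit interval, since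
  \<open>2 * u * (6/5 - u) \<le> 18/25 < 1\<close>.
\<close>
definition error_barrier :: "real \<Rightarrow> real \<Rightarrow> real" where
  "error_barrier y s = (6 / 5 * y - s) / y\<^sup>2"

lemma error_barrier_ge: "0 < y \<Longrightarrow> s \<le> y \<Longrightarrow> 1 / (5 * y) \<le> error_barrier y s"
  by (simp add: error_barrier_def field_simps power2_eq_square)

lemma inverse_pronic_le:
  fixes y :: real
  assumes "5 \<le> y"
  shows "1 / (y * (y - 1)) \<le> 5 / 4 / y\<^sup>2"
  using assms by (simp add: field_simps power2_eq_square)

lemma error_barrier_step:
  assumes y: "5 \<le> y" and s: "0 \<le> s" "s + 1 \<le> y - 2"
  shows "error_barrier y (s + 1) + 2 * (s / (y * (y - 1))) * error_barrier (y - 2) (s + 1)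
    \<le> error_barrier y s - 1 / 10 / y\<^sup>2"
proof -
  have "s * (6 / 5 * (y - 2) - (s + 1)) \<le> s * (6 / 5 * (y - 2) - s)"
    using s by (intro mult_left_mono) auto
  also have "\<dots> = 9 / 25 * (y - 2)\<^sup>2 - (3 / 5 * (y - 2) - s)\<^sup>2"
    by (simp add: power2_eq_square field_simps)
  finally have "s * (6 / 5 * (y - 2) - (s + 1)) \<le> 9 / 25 * (y - 2)\<^sup>2"
    using zero_le_power2[of "3 / 5 * (y - 2) - s"] by linarith
  then have "s * error_barrier (y - 2) (s + 1) \<le> 9 / 25"
    using y by (simp add: error_barrier_def divide_le_eq)
  then have "2 * (s * error_barrier (y - 2) (s + 1)) * (1 / (y * (y - 1)))
      \<le> 2 * (9 / 25) * (5 / 4 / y\<^sup>2)"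
    using y inverse_pronic_le[OF y]
    by (intro mult_mono[of "2 * (s * error_barrier (y - 2) (s + 1))"]) auto
  moreover have "error_barrier y (s + 1) = error_barrier y s - 1 / y\<^sup>2"
    by (simp add: error_barrier_def diff_divide_distrib add_divide_distrib)
  ultimately show ?thesis by (simp add: mult_ac)
qed

section \<open>The normalised generating function\<close>

lemma norm_mult_le_left:
  fixes z w :: "'a::real_normed_algebra"
  assumes "norm z \<le> c" "norm w \<le> 1"
  shows "norm (z * w) \<le> c"
  using norm_mult_ineq[of z w] mult_left_le[OF assms(2), of "norm z"] assms(1) by simp

locale staircase_pgf =
  fixes \<alpha> \<beta> :: real and t :: complex
  assumes alpha_pos: "\<alpha> > 0" and beta_pos: "\<beta> > 0" and norm_t: "norm t \<le> 1"
begin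

abbreviation \<tau> :: complex where "\<tau> \<equiv> t - 1"

lemma norm_tau: "norm \<tau> \<le> 2"
  using norm_triangle_ineq4[of t 1] norm_t by simp

lemma Re_tau: "Re \<tau> \<le> 0"
  using complex_Re_le_cmod[of t] norm_t by simp

text \<open>
  The recursion for \<^const>\<open>tableau_gf\<close> keeps the argument \<open>\<beta> * s\<close> or moves it to \<open>\<beta> * (s + 1)\<close>. In terms
  of \<open>s\<close>, the values at \<open>t = 1\<close> are Pochhammer symbols.
\<close>
definition scaled_gf :: "nat \<Rightarrow> real \<Rightarrow> complex" where
  "scaled_gf n s = tableau_gf (of_real \<alpha>) (of_real \<beta>) t n (of_real (\<beta> * s)) / of_real ((\<alpha> * \<beta>) ^ n)"

definition pgf :: "nat \<Rightarrow> real \<Rightarrow> complex" where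
  "pgf n s = scaled_gf n s / of_real (pochhammer (s + 1 / \<alpha>) n)"

lemma pochhammer_gt_0: "0 \<le> s \<Longrightarrow> 0 < pochhammer (s + 1 / \<alpha>) n"
  using alpha_pos by (intro pochhammer_pos add_nonneg_pos) auto

lemma scaled_gf_eq: "0 \<le> s \<Longrightarrow> scaled_gf n s = of_real (pochhammer (s + 1 / \<alpha>) n) * pgf n s"
  using pochhammer_gt_0[of s n] by (simp add: pgf_def)

lemma pgf_eq_quotient:
  "pgf n s = tableau_gf (of_real \<alpha>) (of_real \<beta>) t n (of_real (\<beta> * s)) /
     of_real (tableau_gf \<alpha> \<beta> 1 n (\<beta> * s))"
  using alpha_pos by (simp add: pgf_def scaled_gf_def tableau_gf_at_1)

lemma norm_pgf_le_1:
  assumes "0 \<le> s"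
  shows "norm (pgf n s) \<le> 1"
proof -
  have "norm (tableau_gf (of_real \<alpha>) (of_real \<beta>) t n (of_real (\<beta> * s)))
      \<le> tableau_gf \<alpha> \<beta> 1 n (\<beta> * s)"
    using alpha_pos beta_pos norm_t assms by (intro norm_tableau_gf_le) auto
  moreover have "0 < tableau_gf \<alpha> \<beta> 1 n (\<beta> * s)"
    using alpha_pos beta_pos assms by (intro tableau_gf_pos) auto
  ultimately show ?thesis by (simp add: pgf_eq_quotient norm_divide)
qed

lemma scaled_gf_rec:
  "scaled_gf (k + 3) s = of_real (s + 1 / \<alpha>) * scaled_gf (k + 2) (s + 1) +
     \<tau> * of_real s * (of_real (s + 1 / \<alpha>) * scaled_gf k (s + 1) + 2 * scaled_gf k s +
       (if k = 0 then 0 else \<tau> * of_real s * scaled_gf (k - 1) s))"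
proof -
  define p :: complex where "p = of_real (\<alpha> * \<beta>)"
  define gf where "gf n s = tableau_gf (of_real \<alpha>) (of_real \<beta>) t n (of_real (\<beta> * s))" for n s
  have p: "p \<noteq> 0" using alpha_pos beta_pos by (simp add: p_def)
  have scaled: "scaled_gf n s = gf n s / p ^ n" for n s
    by (simp add: scaled_gf_def gf_def p_def)
  have linear: "of_real \<alpha> * of_real (\<beta> * s) + of_real \<beta> = p * of_real (s + 1 / \<alpha>)"
    using alpha_pos by (simp add: p_def algebra_simps)
  have shift: "of_real (\<beta> * s) + of_real \<beta> = (of_real (\<beta> * (s + 1)) :: complex)"
    by (simp add: algebra_simps)
  have square: "\<tau> * (of_real \<alpha>)\<^sup>2 * of_real \<beta> * of_real (\<beta> * s) = \<tau> * p\<^sup>2 * of_real s"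
    by (simp add: p_def power_mult_distrib power2_eq_square)
  have double: "2 * of_real \<alpha> * of_real \<beta> = 2 * p" by (simp add: p_def)
  have rec: "gf (k + 3) s = p * of_real (s + 1 / \<alpha>) * gf (k + 2) (s + 1) +
      \<tau> * p\<^sup>2 * of_real s * (p * of_real (s + 1 / \<alpha>) * gf k (s + 1) + 2 * p * gf k s +
        (if k = 0 then 0 else \<tau> * p\<^sup>2 * of_real s * gf (k - 1) s))"
    unfolding gf_def tableau_gf_rec linear shift square double ..
  define c where "c = (of_real (s + 1 / \<alpha>) :: complex)"
  show ?thesis
  proof (cases k)
    case 0
    then show ?thesis
      unfolding scaled rec c_def[symmetric] using p
      by (simp add: field_simps power2_eq_square eval_nat_numeral)
  next
    case (Suc l)
    then show ?thesis
      unfolding scaled rec c_def[symmetric] using p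
      by (simp add: field_simps power2_eq_square eval_nat_numeral)
  qed
qed

text \<open>
  The last factor of the Pochhammer symbol. In the limit, \<^term>\<open>pgf n s\<close> depends on the ratio of \<open>s\<close> and
  \<open>level n s\<close> only.
\<close>
definition level :: "nat \<Rightarrow> real \<Rightarrow> real" where
  "level n s = s + 1 / \<alpha> + real n - 1"

lemma level_gt: "m \<le> n \<Longrightarrow> s + real m - 1 < level n s"
  unfolding level_def using alpha_pos by (intro diff_strict_right_mono add_less_le_mono) auto

lemma pochhammer_level:
  fixes k :: nat
  assumes s: "0 \<le> s"
  defines "x \<equiv> s + 1 / \<alpha>" and "y \<equiv> level (k + 3) s"
  shows "x * pochhammer (x + 1) (k + 2) = pochhammer x (k + 3)"
    and "x * pochhammer (x + 1) k = pochhammer x (k + 3) * (1 / (y * (y - 1)))"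
    and "pochhammer x k = pochhammer x (k + 3) * (1 / (y * (y - 1) * (y - 2)))"
    and "k \<noteq> 0 \<Longrightarrow> pochhammer x (k - 1) =
      pochhammer x (k + 3) * (1 / (y * (y - 1) * (y - 2) * (y - 3)))"
proof -
  have "x > 0" using s alpha_pos by (simp add: x_def add_nonneg_pos)
  have y: "y = x + real k + 2" by (simp add: y_def x_def level_def)
  have y_pos: "y > 0" "y - 1 > 0" "y - 2 > 0" using \<open>x > 0\<close> by (simp_all add: y)
  show shifted: "x * pochhammer (x + 1) (k + 2) = pochhammer x (k + 3)"
    by (simp add: eval_nat_numeral pochhammer_rec)
  have "pochhammer x (k + 3) = x * pochhammer (x + 1) k * (y * (y - 1))"
    unfolding shifted[symmetric] by (simp add: eval_nat_numeral pochhammer_Suc y algebra_simps)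
  then show "x * pochhammer (x + 1) k = pochhammer x (k + 3) * (1 / (y * (y - 1)))"
    using y_pos by simp
  have unshifted: "pochhammer x (k + 3) = pochhammer x k * (y * (y - 1) * (y - 2))"
    by (simp add: eval_nat_numeral pochhammer_Suc y algebra_simps)
  then show "pochhammer x k = pochhammer x (k + 3) * (1 / (y * (y - 1) * (y - 2)))"
    using y_pos by simp
  assume "k \<noteq> 0"
  then have "pochhammer x k = pochhammer x (k - 1) * (y - 3)"
    by (cases k) (simp_all add: pochhammer_Suc y)
  moreover have "y - 3 > 0" using \<open>x > 0\<close> \<open>k \<noteq> 0\<close> by (simp add: y)
  ultimately show "pochhammer x (k - 1) =
      pochhammer x (k + 3) * (1 / (y * (y - 1) * (y - 2) * (y - 3)))"
    unfolding unshifted using y_pos by simp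
qed

lemma pgf_rec:
  fixes k :: nat
  assumes s: "0 \<le> s"
  defines "y \<equiv> level (k + 3) s"
  shows "pgf (k + 3) s = pgf (k + 2) (s + 1) + \<tau> * of_real (s / (y * (y - 1))) * pgf k (s + 1) +
     \<tau> * of_real (2 * s / (y * (y - 1) * (y - 2))) * pgf k s +
     (if k = 0 then 0
      else \<tau>\<^sup>2 * of_real (s\<^sup>2 / (y * (y - 1) * (y - 2) * (y - 3))) * pgf (k - 1) s)"
    (is "_ = ?rhs")
proof -
  define x where "x = s + 1 / \<alpha>"
  note pochhammer = pochhammer_level[OF s, of k, folded x_def y_def]
  have shifted: "s + 1 + 1 / \<alpha> = x + 1" by (simp add: x_def)
  have scaled: "scaled_gf (k + 3) s =
     of_real (x * pochhammer (x + 1) (k + 2)) * pgf (k + 2) (s + 1) +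
     \<tau> * of_real s * (of_real (x * pochhammer (x + 1) k) * pgf k (s + 1) +
       2 * (of_real (pochhammer x k) * pgf k s) +
       (if k = 0 then 0 else \<tau> * of_real s * (of_real (pochhammer x (k - 1)) * pgf (k - 1) s)))"
    using s unfolding scaled_gf_rec by (simp add: scaled_gf_eq shifted x_def[symmetric])
  have "scaled_gf (k + 3) s = of_real (pochhammer x (k + 3)) * ?rhs"
  proof (cases "k = 0")
    case True
    then show ?thesis
      unfolding scaled pochhammer(1-3) by (simp add: algebra_simps)
  next
    case False
    then show ?thesis
      unfolding scaled pochhammer(1-3) pochhammer(4)[OF False]
      by (simp add: algebra_simps power2_eq_square)
  qed
  then show ?thesis
    using pochhammer_gt_0[OF s, of "k + 3"] by (simp add: pgf_def[of "k + 3"] x_def)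
qed

lemma pgf_rec_remainder:
  fixes k :: nat
  assumes s: "0 \<le> s" and "k \<noteq> 0"
  defines "y \<equiv> level (k + 3) s"
  assumes y: "5 \<le> y"
  shows "norm (pgf (k + 3) s - pgf (k + 2) (s + 1) -
    \<tau> * of_real (s / (y * (y - 1))) * pgf k (s + 1)) \<le> 10 / y\<^sup>2"
proof -
  have s_le: "s \<le> y - 3" using level_gt[of 4 "k + 3" s] \<open>k \<noteq> 0\<close> by (simp add: y_def)
  have "2 * s / (y * (y - 1) * (y - 2)) = 2 * (s / (y - 2)) * (1 / (y * (y - 1)))"
    by (simp add: mult_ac)
  also have "\<dots> \<le> 2 * 1 * (5 / 4 / y\<^sup>2)"
    using s s_le y by (intro mult_mono inverse_pronic_le) auto
  finally have "norm (\<tau> * of_real (2 * s / (y * (y - 1) * (y - 2)))) \<le> 2 * (2 * 1 * (5 / 4 / y\<^sup>2))"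
    unfolding norm_mult norm_of_real using s y norm_tau
    by (intro mult_mono[of "norm \<tau>"]) (auto simp: abs_of_nonneg)
  then have next_term: "norm (\<tau> * of_real (2 * s / (y * (y - 1) * (y - 2))) * pgf k s) \<le> 5 / y\<^sup>2"
    by (intro norm_mult_le_left[OF _ norm_pgf_le_1[OF s]]) simp
  have "s\<^sup>2 / (y * (y - 1) * (y - 2) * (y - 3)) =
      s / (y - 2) * (s / (y - 3)) * (1 / (y * (y - 1)))"
    by (simp add: power2_eq_square mult_ac)
  also have "\<dots> \<le> 1 * 1 * (5 / 4 / y\<^sup>2)"
    using s s_le y by (intro mult_mono inverse_pronic_le) auto
  finally have "norm (\<tau>\<^sup>2 * of_real (s\<^sup>2 / (y * (y - 1) * (y - 2) * (y - 3))))
      \<le> 2\<^sup>2 * (1 * 1 * (5 / 4 / y\<^sup>2))"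
    unfolding norm_mult norm_power norm_of_real using s y norm_tau
    by (intro mult_mono power_mono) auto
  then have last_term:
    "norm (\<tau>\<^sup>2 * of_real (s\<^sup>2 / (y * (y - 1) * (y - 2) * (y - 3))) * pgf (k - 1) s) \<le> 5 / y\<^sup>2"
    by (intro norm_mult_le_left[OF _ norm_pgf_le_1[OF s]]) simp
  have "pgf (k + 3) s - pgf (k + 2) (s + 1) - \<tau> * of_real (s / (y * (y - 1))) * pgf k (s + 1) =
      \<tau> * of_real (2 * s / (y * (y - 1) * (y - 2))) * pgf k s +
      \<tau>\<^sup>2 * of_real (s\<^sup>2 / (y * (y - 1) * (y - 2) * (y - 3))) * pgf (k - 1) s"
    using pgf_rec[OF s, of k, folded y_def] \<open>k \<noteq> 0\<close> by simp
  also have "norm \<dots> \<le> 5 / y\<^sup>2 + 5 / y\<^sup>2"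
    by (rule norm_triangle_mono[OF next_term last_term])
  finally show ?thesis by simp
qed

lemma pgf_small:
  assumes "0 \<le> s" "n \<le> 2"
  shows "pgf n s = 1"
proof -
  have "0 < tableau_gf \<alpha> \<beta> 1 n (\<beta> * s)"
    using alpha_pos beta_pos assms(1) by (intro tableau_gf_pos) auto
  then show ?thesis
    unfolding pgf_eq_quotient tableau_gf_small[OF assms(2), of _ _ t] tableau_gf_of_real by simp
qed

lemma pgf_near_1:
  assumes s: "0 \<le> s" and n: "1 \<le> n" "n \<le> 3"
  shows "norm (pgf n s - 1) \<le> 6 / level n s"
proof (cases "n = 3")
  case True
  define y where "y = level 3 s"
  have y: "s < y - 2" using level_gt[of 3 3 s] by (simp add: y_def)
  have "norm (\<tau> * of_real (s / (y * (y - 1)))) \<le> 2 * (1 / y)"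
    unfolding norm_mult norm_of_real
  proof (intro mult_mono norm_tau)
    show "\<bar>s / (y * (y - 1))\<bar> \<le> 1 / y"
      using s y by (intro abs_divide_pronic_le) auto
  qed auto
  moreover have "norm (\<tau> * of_real (2 * s / (y * (y - 1) * (y - 2)))) \<le> 2 * (2 / y)"
    unfolding norm_mult norm_of_real
  proof (intro mult_mono norm_tau)
    have "s / (y - 2) * (2 / (y - 1)) * (1 / y) \<le> 1 * 2 * (1 / y)"
      using s y by (intro mult_mono) (auto simp: divide_le_eq)
    then show "\<bar>2 * s / (y * (y - 1) * (y - 2))\<bar> \<le> 2 / y" using s y by (simp add: mult_ac)
  qed auto
  moreover have "pgf 3 s - 1 = \<tau> * of_real (s / (y * (y - 1))) +
      \<tau> * of_real (2 * s / (y * (y - 1) * (y - 2)))"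
    using pgf_rec[OF s, of 0] s by (simp add: pgf_small y_def)
  ultimately have "norm (pgf 3 s - 1) \<le> 2 * (1 / y) + 2 * (2 / y)"
    by (simp only: norm_triangle_mono)
  then show ?thesis unfolding True y_def[symmetric] by simp
next
  case False
  then show ?thesis using s n level_gt[of 1 n s] by (simp add: pgf_small)
qed

definition pgf_error :: "nat \<Rightarrow> real \<Rightarrow> real" where
  "pgf_error n s = norm (pgf n s - limit_profile \<tau> (of_real (s / level n s)))"

lemma norm_limit_profile_level:
  assumes "1 \<le> n" "0 \<le> s"
  shows "norm (limit_profile \<tau> (of_real (s / level n s))) \<le> 1"
  using level_gt[of 1 n s] assms by (intro norm_limit_profile Re_tau) auto

lemma pgf_error_le_2: "1 \<le> n \<Longrightarrow> 0 \<le> s \<Longrightarrow> pgf_error n s \<le> 2"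
  using norm_triangle_ineq4[of "pgf n s" "limit_profile \<tau> (of_real (s / level n s))"]
    norm_pgf_le_1[of s n] norm_limit_profile_level[of n s] by (simp add: pgf_error_def)

lemma pgf_error_small:
  assumes n: "1 \<le> n" "n \<le> 3" and s: "0 \<le> s"
  shows "pgf_error n s \<le> (10 + 2 / \<alpha>) / level n s"
proof -
  define y where "y = level n s"
  have y: "s < y" using level_gt[OF n(1), of s] by (simp add: y_def)
  have "norm (limit_profile \<tau> (of_real 1) - limit_profile \<tau> (of_real (s / y)))
      \<le> norm \<tau> * \<bar>1 - s / y\<bar>"
    using s y by (intro limit_profile_Lipschitz Re_tau) auto
  also have "\<bar>1 - s / y\<bar> = (y - s) / y" using s y by (simp add: diff_divide_distrib)
  also have "norm \<tau> * ((y - s) / y) \<le> 2 * ((2 + 1 / \<alpha>) / y)"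
    using s y n norm_tau by (intro mult_mono divide_right_mono) (auto simp: y_def level_def)
  finally have "norm (1 - limit_profile \<tau> (of_real (s / y))) \<le> 2 * ((2 + 1 / \<alpha>) / y)"
    by (simp add: limit_profile_def)
  then have "norm ((pgf n s - 1) + (1 - limit_profile \<tau> (of_real (s / y)))) \<le>
      6 / y + 2 * ((2 + 1 / \<alpha>) / y)"
    using pgf_near_1[OF s n] by (intro norm_triangle_mono) (simp_all add: y_def)
  then show ?thesis
    by (simp add: pgf_error_def y_def[symmetric] add_divide_distrib[symmetric])
qed

lemma pgf_error_rec:
  fixes k :: nat
  assumes s: "0 \<le> s" and k: "k \<noteq> 0"
  defines "y \<equiv> level (k + 3) s"
  assumes y: "5 \<le> y"
  shows "pgf_error (k + 3) s \<le>
    pgf_error (k + 2) (s + 1) + 2 * (s / (y * (y - 1))) * pgf_error k (s + 1) + 30 / y\<^sup>2"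
proof -
  let ?c = "\<tau> * of_real (s / (y * (y - 1)))"
  define \<phi> where "\<phi> s y = limit_profile \<tau> (of_real (s / y))" for s y
  have levels: "level (k + 2) (s + 1) = y" "level k (s + 1) = y - 2"
    by (simp_all add: y_def level_def)
  have s_le: "s + 1 \<le> y - 2" using level_gt[of 4 "k + 3" s] k by (simp add: y_def)
  have errors: "pgf_error (k + 3) s = norm (pgf (k + 3) s - \<phi> s y)"
    "pgf_error (k + 2) (s + 1) = norm (pgf (k + 2) (s + 1) - \<phi> (s + 1) y)"
    "pgf_error k (s + 1) = norm (pgf k (s + 1) - \<phi> (s + 1) (y - 2))"
    by (simp_all only: pgf_error_def levels \<phi>_def y_def)
  have "norm ?c \<le> 2 * (s / (y * (y - 1)))"
    unfolding norm_mult norm_of_real using norm_tau s y by (intro mult_mono) auto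
  then have coeff: "norm (?c * (pgf k (s + 1) - \<phi> (s + 1) (y - 2))) \<le>
      2 * (s / (y * (y - 1))) * pgf_error k (s + 1)"
    unfolding norm_mult[of ?c] errors(3) by (intro mult_right_mono) auto
  have "norm (\<phi> (s + 1) y + ?c * \<phi> (s + 1) (y - 2) - \<phi> s y) \<le>
      (2 * norm \<tau> + 4 * (norm \<tau>)\<^sup>2) / y\<^sup>2"
    using limit_profile_residual[OF Re_tau s s_le] unfolding \<phi>_def
    by (subst norm_minus_commute) (simp only: diff_diff_eq)
  also have "\<dots> \<le> (2 * 2 + 4 * 2\<^sup>2) / y\<^sup>2"
    using norm_tau by (intro divide_right_mono add_mono mult_left_mono power_mono) auto
  finally have residual: "norm (\<phi> (s + 1) y + ?c * \<phi> (s + 1) (y - 2) - \<phi> s y) \<le> 20 / y\<^sup>2"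
    by simp
  have "pgf (k + 3) s - \<phi> s y = (pgf (k + 2) (s + 1) - \<phi> (s + 1) y)
      + ?c * (pgf k (s + 1) - \<phi> (s + 1) (y - 2))
      + (pgf (k + 3) s - pgf (k + 2) (s + 1) - ?c * pgf k (s + 1))
      + (\<phi> (s + 1) y + ?c * \<phi> (s + 1) (y - 2) - \<phi> s y)"
    by (simp only: right_diff_distrib) simp
  also have "norm \<dots> \<le> pgf_error (k + 2) (s + 1) + 2 * (s / (y * (y - 1))) * pgf_error k (s + 1)
      + 10 / y\<^sup>2 + 20 / y\<^sup>2"
    by (intro norm_triangle_mono coeff residual pgf_rec_remainder[OF s k, folded y_def, OF y])
      (simp only: errors order_refl)
  finally show ?thesis by (simp add: errors(1))
qed

lemma pgf_error_step:
  fixes k :: nat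
  assumes s: "0 \<le> s" and k: "k \<noteq> 0" and K: "300 \<le> K"
  defines "y \<equiv> level (k + 3) s"
  assumes y: "5 \<le> y"
    and "pgf_error (k + 2) (s + 1) \<le> K * error_barrier y (s + 1)"
    and "pgf_error k (s + 1) \<le> K * error_barrier (y - 2) (s + 1)"
  shows "pgf_error (k + 3) s \<le> K * error_barrier y s"
proof -
  have s_le: "s + 1 \<le> y - 2" using level_gt[of 4 "k + 3" s] k by (simp add: y_def)
  have slack: "30 / y\<^sup>2 \<le> K * (1 / 10 / y\<^sup>2)"
    using K divide_right_mono[of 30 "K / 10" "y\<^sup>2"] by simp
  have "pgf_error (k + 3) s \<le> pgf_error (k + 2) (s + 1) +
      2 * (s / (y * (y - 1))) * pgf_error k (s + 1) + 30 / y\<^sup>2"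
    using s k y unfolding y_def by (rule pgf_error_rec)
  also have "\<dots> \<le> K * error_barrier y (s + 1) +
      2 * (s / (y * (y - 1))) * (K * error_barrier (y - 2) (s + 1)) + 30 / y\<^sup>2"
    using assms(6,7) s y by (intro add_mono mult_left_mono) auto
  also have "\<dots> = K * (error_barrier y (s + 1) +
      2 * (s / (y * (y - 1))) * error_barrier (y - 2) (s + 1)) + 30 / y\<^sup>2"
    by (simp add: algebra_simps)
  also have "\<dots> \<le> K * (error_barrier y s - 1 / 10 / y\<^sup>2) + 30 / y\<^sup>2"
    using s s_le y K by (intro add_right_mono mult_left_mono error_barrier_step) auto
  also have "\<dots> \<le> K * error_barrier y s"
    using slack by (simp add: right_diff_distrib)
  finally show ?thesis .
qed

lemma pgf_error_le:
  assumes "1 \<le> n" "0 \<le> s"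
  shows "pgf_error n s \<le> (300 + 10 / \<alpha>) * error_barrier (level n s) s"
  using assms
proof (induction n arbitrary: s rule: less_induct)
  case (less n s)
  define y where "y = level n s"
  define K where "K = 300 + 10 / \<alpha>"
  have K: "300 \<le> K" using alpha_pos by (simp add: K_def)
  have y: "0 < y" "s < y" using level_gt[OF less.prems(1), of s] less.prems by (auto simp: y_def)
  have crude: "pgf_error n s \<le> K * error_barrier y s" if "pgf_error n s \<le> K / 5 / y"
  proof -
    have "K * (1 / (5 * y)) \<le> K * error_barrier y s"
      using y K by (intro mult_left_mono error_barrier_ge) auto
    then show ?thesis using that by simp
  qed
  consider (small) "n \<le> 3" | (low) "y < 5" | (step) "n > 3" "y \<ge> 5" by linarith
  then have "pgf_error n s \<le> K * error_barrier y s"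
  proof cases
    case small
    then have "pgf_error n s \<le> (10 + 2 / \<alpha>) / y"
      using less.prems unfolding y_def by (intro pgf_error_small)
    also have "\<dots> \<le> K / 5 / y"
      using y by (intro divide_right_mono) (auto simp: K_def)
    finally show ?thesis by (rule crude)
  next
    case low
    have "pgf_error n s \<le> 2" using less.prems by (rule pgf_error_le_2)
    also have "2 \<le> K / 5 / y" using low y K by (simp add: field_simps)
    finally show ?thesis by (rule crude)
  next
    case step
    define k where "k = n - 3"
    have k: "n = k + 3" "k \<noteq> 0" using step by (auto simp: k_def)
    have levels: "level (k + 2) (s + 1) = y" "level k (s + 1) = y - 2"
      by (simp_all add: y_def level_def k)
    show ?thesis
      using less.IH[of "k + 2" "s + 1"] less.IH[of k "s + 1"] less.prems k step K
      unfolding levels K_def[symmetric] y_def k(1) by (intro pgf_error_step) simp_all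
  qed
  then show ?case unfolding K_def y_def .
qed

lemma pgf_tendsto:
  assumes s: "0 \<le> s"
  shows "(\<lambda>n. pgf n s) \<longlonglongrightarrow> exp (\<tau> / 2)"
proof -
  have "(\<lambda>n. s / level n s) \<longlonglongrightarrow> 0"
    unfolding level_def by real_asymp
  then have "(\<lambda>n. limit_profile \<tau> (of_real (s / level n s))) \<longlonglongrightarrow> exp (\<tau> / 2 * (1 - (of_real 0)\<^sup>2))"
    unfolding limit_profile_def by (intro tendsto_intros)
  moreover have "(\<lambda>n. pgf n s - limit_profile \<tau> (of_real (s / level n s))) \<longlonglongrightarrow> 0"
  proof (rule Lim_null_comparison)
    show "\<forall>\<^sub>F n in sequentially. norm (pgf n s - limit_profile \<tau> (of_real (s / level n s))) \<le>
        (300 + 10 / \<alpha>) * error_barrier (level n s) s"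
      using eventually_ge_at_top[of 1]
      by eventually_elim (use pgf_error_le s in \<open>simp add: pgf_error_def\<close>)
    show "(\<lambda>n. (300 + 10 / \<alpha>) * error_barrier (level n s) s) \<longlonglongrightarrow> 0"
      unfolding error_barrier_def level_def by real_asymp
  qed
  ultimately have "(\<lambda>n. (pgf n s - limit_profile \<tau> (of_real (s / level n s))) +
      limit_profile \<tau> (of_real (s / level n s))) \<longlonglongrightarrow> 0 + exp (\<tau> / 2 * (1 - (of_real 0)\<^sup>2))"
    by (intro tendsto_add)
  then show ?thesis by simp
qed

end

section \<open>Convergence in distribution\<close>

lemma tableau_gf_eq_sum_wt: "tableau_gf \<alpha> \<beta> 1 n 1 = (\<Sum>S\<in>staircase_tableaux n. wt \<alpha> \<beta> n S)"
  by (simp add: tableau_gf_def tableau_sum_def tableau_weight_def wt_def)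

lemma pmf_tableau_law:
  assumes "\<alpha> > 0" "\<beta> > 0"
  shows "pmf (tableau_law \<alpha> \<beta> n) S =
    (if S \<in> staircase_tableaux n then wt \<alpha> \<beta> n S / tableau_gf \<alpha> \<beta> 1 n 1 else 0)"
proof -
  let ?f = "\<lambda>S. if S \<in> staircase_tableaux n then wt \<alpha> \<beta> n S / tableau_gf \<alpha> \<beta> 1 n 1 else 0"
  have gf_pos: "tableau_gf \<alpha> \<beta> 1 n 1 > 0" using assms by (intro tableau_gf_pos) auto
  have nonneg: "0 \<le> ?f S" for S using assms gf_pos by (simp add: wt_def)
  have "(\<integral>\<^sup>+S. ennreal (?f S) \<partial>count_space UNIV) = (\<Sum>S\<in>staircase_tableaux n. ennreal (?f S))"
    by (rule nn_integral_count_space'[OF finite_staircase_tableaux]) auto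
  also have "\<dots> = ennreal (\<Sum>S\<in>staircase_tableaux n. ?f S)"
    using nonneg by (rule sum_ennreal)
  also have "(\<Sum>S\<in>staircase_tableaux n. ?f S) = 1"
    using gf_pos by (simp add: sum_divide_distrib[symmetric] tableau_gf_eq_sum_wt)
  finally have "(\<integral>\<^sup>+S. ennreal (?f S) \<partial>count_space UNIV) = 1" by simp
  then show ?thesis
    unfolding tableau_law_def tableau_gf_eq_sum_wt[symmetric] by (intro pmf_embed_pmf nonneg)
qed

lemma expectation_power_A3:
  fixes t :: complex
  assumes "\<alpha> > 0" "\<beta> > 0"
  shows "(\<integral>S. t ^ A3 n S \<partial>measure_pmf (tableau_law \<alpha> \<beta> n)) =
    tableau_gf (of_real \<alpha>) (of_real \<beta>) t n 1 / of_real (tableau_gf \<alpha> \<beta> 1 n 1)"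
proof -
  have "(\<integral>S. t ^ A3 n S \<partial>measure_pmf (tableau_law \<alpha> \<beta> n)) =
      (\<Sum>S\<in>staircase_tableaux n. pmf (tableau_law \<alpha> \<beta> n) S *\<^sub>R t ^ A3 n S)"
    using finite_staircase_tableaux
    by (rule integral_measure_pmf)
      (auto simp: set_pmf_iff pmf_tableau_law[OF assms] split: if_splits)
  also have "\<dots> = (\<Sum>S\<in>staircase_tableaux n. tableau_weight (of_real \<alpha>) (of_real \<beta>) t n S) /
      of_real (tableau_gf \<alpha> \<beta> 1 n 1)"
    unfolding sum_divide_distrib
    by (intro sum.cong refl)
      (simp add: pmf_tableau_law[OF assms] scaleR_conv_of_real wt_def tableau_weight_def)
  finally show ?thesis
    by (simp add: tableau_gf_def tableau_sum_def)
qed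

lemma (in staircase_pgf) expectation_power_A3_eq_pgf:
  "(\<integral>S. t ^ A3 n S \<partial>measure_pmf (tableau_law \<alpha> \<beta> n)) = pgf n (1 / \<beta>)"
  using alpha_pos beta_pos by (simp add: expectation_power_A3 pgf_eq_quotient)

lemma expectation_power_poisson:
  fixes t :: complex
  assumes "0 < r" "norm t \<le> 1"
  shows "(\<integral>k. t ^ k \<partial>measure_pmf (poisson_pmf r)) = exp (of_real r * (t - 1))"
proof -
  let ?f = "\<lambda>k. pmf (poisson_pmf r) k *\<^sub>R t ^ k"
  have "(\<lambda>k. of_real (exp (- r)) * ((of_real r * t) ^ k /\<^sub>R fact k)) sums
      (of_real (exp (- r)) * exp (of_real r * t))"
    by (intro sums_mult exp_converges)
  also have "(\<lambda>k. of_real (exp (- r)) * ((of_real r * t) ^ k /\<^sub>R fact k)) = ?f"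
    using \<open>0 < r\<close> by (simp add: fun_eq_iff scaleR_conv_of_real power_mult_distrib field_simps)
  also have "of_real (exp (- r)) * exp (of_real r * t) = exp (of_real r * (t - 1))"
    by (simp add: exp_of_real[symmetric] exp_add[symmetric] algebra_simps)
  finally have sums: "?f sums exp (of_real r * (t - 1))" .
  have "norm (t ^ k) \<le> 1" for k
    using assms(2) by (simp add: norm_power power_le_one)
  then have "integrable (count_space UNIV) ?f"
    by (intro Bochner_Integration.integrable_bound[OF integrable_pmf[of UNIV "poisson_pmf r"]])
      (auto simp: mult_left_le)
  moreover have "(\<integral>k. t ^ k \<partial>measure_pmf (poisson_pmf r)) = (\<integral>k. ?f k \<partial>count_space UNIV)"
    unfolding measure_pmf_eq_density by (rule integral_density) auto
  ultimately show ?thesis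
    using integral_count_space_nat[of ?f] sums_unique[OF sums] by metis
qed

lemma char_distr_nat_pmf:
  fixes f :: "'a \<Rightarrow> nat"
  shows "char (distr (measure_pmf p) borel (\<lambda>x. real (f x))) \<theta> = (\<integral>x. iexp \<theta> ^ f x \<partial>measure_pmf p)"
  unfolding char_def by (subst integral_distr) (simp_all add: exp_of_nat_mult[symmetric] mult_ac)

text \<open>
  The measure of a pmf carries the discrete sigma-algebra, so Levy continuity only applies to the
  push-forwards to \<^const>\<open>borel\<close>.
\<close>
lemma cdf_map_pmf: "cdf (measure_pmf (map_pmf f p)) = cdf (distr (measure_pmf p) borel f)"
  by (auto simp: fun_eq_iff cdf_def measure_distr)

lemma weak_conv_m_nat_pmf:
  fixes f :: "nat \<Rightarrow> 'a \<Rightarrow> nat" and g :: "'b \<Rightarrow> nat"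
  assumes "\<And>t :: complex. norm t = 1 \<Longrightarrow>
    (\<lambda>n. \<integral>x. t ^ f n x \<partial>measure_pmf (p n)) \<longlonglongrightarrow> (\<integral>x. t ^ g x \<partial>measure_pmf q)"
  shows "weak_conv_m (\<lambda>n. measure_pmf (map_pmf (\<lambda>x. real (f n x)) (p n)))
    (measure_pmf (map_pmf (\<lambda>x. real (g x)) q))"
proof -
  have "weak_conv_m (\<lambda>n. distr (measure_pmf (p n)) borel (\<lambda>x. real (f n x)))
     (distr (measure_pmf q) borel (\<lambda>x. real (g x)))"
    by (rule levy_continuity)
      (auto intro!: prob_space.real_distribution_distr measure_pmf.prob_space_axioms assms
        simp: char_distr_nat_pmf)
  then show ?thesis
    by (simp add: weak_conv_m_def cdf_map_pmf)
qed

theorem theorem4p3: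
  fixes \<alpha> \<beta> :: real
  assumes "\<alpha> > 0" and "\<beta> > 0"
  shows "weak_conv_m
           (\<lambda>m. measure_pmf (map_pmf (\<lambda>S. real (A3 (m + 3) S)) (tableau_law \<alpha> \<beta> (m + 3))))
           (measure_pmf (map_pmf real (poisson_pmf (1/2))))"
proof (rule weak_conv_m_nat_pmf)
  fix t :: complex assume t: "norm t = 1"
  then interpret staircase_pgf \<alpha> \<beta> t by unfold_locales (use assms in auto)
  have "(\<lambda>m. pgf (m + 3) (1 / \<beta>)) \<longlonglongrightarrow> exp (\<tau> / 2)"
    using assms by (intro LIMSEQ_ignore_initial_segment pgf_tendsto) simp
  then show "(\<lambda>m. \<integral>S. t ^ A3 (m + 3) S \<partial>measure_pmf (tableau_law \<alpha> \<beta> (m + 3)))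
      \<longlonglongrightarrow> (\<integral>k. t ^ k \<partial>measure_pmf (poisson_pmf (1/2)))"
    using t by (simp add: expectation_power_A3_eq_pgf expectation_power_poisson)
qed

end
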